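(* Let $(\mathfrak g,\theta)$ be of type AIII, $\mathfrak g=\mathfrak{sl}(V)=\mathfrak k\oplus\mathfrak p$. Then the $\mathfrak p$-distinguished elements coincide with the almost $\mathfrak p$-distinguished elements, and they are exactly the nilpotent elements $e\in\mathfrak p$ whose $ab$-diagram has the property that, for each length $d$, all rows of length $d$ begin with the same letter.
   Context: Base field $\Bbbk$ algebraically closed of characteristic $0$; $V$ a finite-dimensional vector space with $\mathfrak{sl}(V)$ simple. Type AIII: $\theta(x)=JxJ^{-1}$ on $\mathfrak g=\mathfrak{sl}(V)$ with $J\in GL(V)$, $J^2=\mathrm{Id}$, $\theta$ nontrivial; $V=V_a\oplus V_b$ is the decomposition of $V$ into the two eigenspaces of $J$ (both nonzero), and $\mathfrak k,\mathfrak p$ are the $+1,-1$ eigenspaces of $\theta$. $\mathcal N$ is the set of nilpotent elements in $\mathfrak p$; $\mathfrak p^e=\{y\in\mathfrak p:[e,y]=0\}$. For $0\ne e\in\mathcal N$ choose a normal $\mathfrak{sl}_2$-triple $(e,h,f)$ ($e,f\in\mathfrak p$, $h\in\mathfrak k$, $[h,e]=2e$, $[h,f]=-2f$, $[e,f]=h$) and let $\mathfrak p(e,0)=\{y\in\mathfrak p^e:[h,y]=0\}$; for $e=0$ put $\mathfrak p(0,0)=\mathfrak p$. $e$ is $\mathfrak p$-distinguished if $\mathfrak p^e\subset\mathcal N$; almost $\mathfrak p$-distinguished if $\mathfrak p(e,0)$ contains no nonzero nilpotent element. $ab$-diagram of $e$: the Young diagram whose row lengths are the Jordan block sizes of $e$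 on $V$, each row being associated with a Jordan string $v,ev,\dots,e^{d-1}v$ ($e^dv=0$) from a basis of $V$ adapted to the triple ($v$ a lowest weight vector) and diagonalizing $J$; a box is filled with $a$ or $b$ according to whether the corresponding basis vector is in $V_a$ or $V_b$ (letters alternate along a row). Rows of the same length are taken up to permutation. The number of rows of length $d$ beginning with $a$ (resp. $b$) is $\dim(H'_d\cap V_a)$ (resp. $\dim (H'_d\cap V_b)$), where $H'_d=\{v\in V: fv=0,\ hv=-(d-1)v\}$ (for $e=0$, $H_1'=V$). *)

theory Defs
  imports "HOL-Computational_Algebra.Computational_Algebra" "HOL-Library.Multiset"
begin

section \<open>Endomorphisms and the special linear Lie algebra\<close>

definition lie_bracket :: "('v \<Rightarrow> 'v) \<Rightarrow> ('v \<Rightarrow> 'v) \<Rightarrow> 'v \<Rightarrow> 'v::ab_group_add" where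
  "lie_bracket x y = (\<lambda>v. x (y v) - y (x v))"

definition nilpotent_map :: "('v \<Rightarrow> 'v::zero) \<Rightarrow> bool" where
  "nilpotent_map x \<longleftrightarrow> (\<exists>n. \<forall>v. (x ^^ n) v = 0)"

locale endomorphisms = finite_dimensional_vector_space scale Basis
  for scale :: "'k::{alg_closed_field, field_char_0} \<Rightarrow> 'v::ab_group_add \<Rightarrow> 'v"
    and Basis :: "'v set"
begin

definition lie_ideal :: "('v \<Rightarrow> 'v) set \<Rightarrow> ('v \<Rightarrow> 'v) set \<Rightarrow> bool" where
  "lie_ideal I L \<longleftrightarrow> I \<subseteq> L \<and> (\<lambda>_. 0) \<in> I \<and>
     (\<forall>x\<in>I. \<forall>y\<in>I. (\<lambda>v. x v + y v) \<in> I) \<and>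
     (\<forall>c. \<forall>x\<in>I. (\<lambda>v. scale c (x v)) \<in> I) \<and>
     (\<forall>x\<in>L. \<forall>y\<in>I. lie_bracket x y \<in> I)"

text \<open>Simplicity of a Lie algebra \<open>L\<close> consisting of endomorphisms.\<close>

definition lie_simple :: "('v \<Rightarrow> 'v) set \<Rightarrow> bool" where
  "lie_simple L \<longleftrightarrow> (\<exists>x\<in>L. \<exists>y\<in>L. lie_bracket x y \<noteq> (\<lambda>_. 0)) \<and>
     (\<forall>I. lie_ideal I L \<longrightarrow> I = {\<lambda>_. 0} \<or> I = L)"

text \<open>The trace is computed in the fixed basis; it does not depend on it.\<close>

definition endo_trace :: "('v \<Rightarrow> 'v) \<Rightarrow> 'k" where
  "endo_trace x = (\<Sum>b\<in>Basis. representation Basis (x b) b)"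

definition sl :: "('v \<Rightarrow> 'v) set" where
  "sl = {x. Vector_Spaces.linear scale scale x \<and> endo_trace x = 0}"

end

section \<open>Symmetric pairs of type AIII\<close>

text \<open>The vector space \<open>V\<close> is the whole type \<open>'v\<close>. The involution \<open>J\<close> acts on
  \<open>sl(V)\<close> by conjugation; this action being nontrivial means that \<open>J\<close> is not \<open>\<plusminus>Id\<close>,
  that is, both of its eigenspaces are nonzero.\<close>

locale AIII = endomorphisms scale Basis
  for scale :: "'k::{alg_closed_field, field_char_0} \<Rightarrow> 'v::ab_group_add \<Rightarrow> 'v"
    and Basis :: "'v set" +
  fixes J :: "'v \<Rightarrow> 'v"
  assumes sl_simple: "lie_simple sl"
    and J_linear: "Vector_Spaces.linear scale scale J"
    and J_involution: "J \<circ> J = id"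
    and conj_J_nontrivial: "\<exists>x\<in>sl. J \<circ> x \<circ> inv J \<noteq> x"
begin

definition theta :: "('v \<Rightarrow> 'v) \<Rightarrow> 'v \<Rightarrow> 'v" where
  "theta x = J \<circ> x \<circ> inv J"

definition Va :: "'v set" where
  "Va = {v. J v = v}"

definition Vb :: "'v set" where
  "Vb = {v. J v = - v}"

definition kk :: "('v \<Rightarrow> 'v) set" where
  "kk = {x \<in> sl. theta x = x}"

definition pp :: "('v \<Rightarrow> 'v) set" where
  "pp = {x \<in> sl. theta x = (\<lambda>v. - x v)}"

definition NN :: "('v \<Rightarrow> 'v) set" where
  "NN = {x \<in> pp. nilpotent_map x}"

definition p_centralizer :: "('v \<Rightarrow> 'v) \<Rightarrow> ('v \<Rightarrow> 'v) set" where
  "p_centralizer e = {y \<in> pp. lie_bracket e y = (\<lambda>_. 0)}"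

definition normal_triple :: "('v \<Rightarrow> 'v) \<Rightarrow> ('v \<Rightarrow> 'v) \<Rightarrow> ('v \<Rightarrow> 'v) \<Rightarrow> bool" where
  "normal_triple e h f \<longleftrightarrow> e \<in> pp \<and> h \<in> kk \<and> f \<in> pp \<and>
     lie_bracket h e = (\<lambda>v. scale 2 (e v)) \<and>
     lie_bracket h f = (\<lambda>v. scale (-2) (f v)) \<and>
     lie_bracket e f = h"

text \<open>The chosen pair \<open>(h, f)\<close> completing \<open>e\<close> to a normal triple. For \<open>e = 0\<close> the
  zero triple is used; this yields \<open>p_zero 0 = pp\<close> (see below) and, for the lowest
  weight spaces, \<open>H'\<^sub>1 = V\<close>.\<close>

definition triple_of :: "('v \<Rightarrow> 'v) \<Rightarrow> ('v \<Rightarrow> 'v) \<times> ('v \<Rightarrow> 'v)" where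
  "triple_of e = (if e = (\<lambda>_. 0) then (\<lambda>_. 0, \<lambda>_. 0)
     else (SOME (h, f). normal_triple e h f))"

text \<open>\<open>p_zero e\<close> is the space \<open>p(e,0)\<close>.\<close>

definition p_zero :: "('v \<Rightarrow> 'v) \<Rightarrow> ('v \<Rightarrow> 'v) set" where
  "p_zero e = {y \<in> p_centralizer e. lie_bracket (fst (triple_of e)) y = (\<lambda>_. 0)}"

lemma p_zero_0: "p_zero (\<lambda>_. 0) = pp"
proof -
  have "y 0 = 0" if "y \<in> pp" for y
    using that module_hom.zero unfolding pp_def sl_def linear_iff_module_hom by blast
  then show ?thesis
    by (auto simp: p_zero_def p_centralizer_def triple_of_def lie_bracket_def)
qed

definition p_distinguished :: "('v \<Rightarrow> 'v) \<Rightarrow> bool" where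
  "p_distinguished e \<longleftrightarrow> e \<in> NN \<and> p_centralizer e \<subseteq> NN"

definition almost_p_distinguished :: "('v \<Rightarrow> 'v) \<Rightarrow> bool" where
  "almost_p_distinguished e \<longleftrightarrow> e \<in> NN \<and> \<not> (\<exists>y \<in> p_zero e. y \<noteq> (\<lambda>_. 0) \<and> nilpotent_map y)"

end

section \<open>Diagrams\<close>

datatype letter = LA | LB

definition jordan_string :: "('v \<Rightarrow> 'v) \<Rightarrow> 'v \<times> nat \<Rightarrow> 'v list" where
  "jordan_string e = (\<lambda>(v, d). map (\<lambda>i. (e ^^ i) v) [0..<d])"

context AIII
begin

text \<open>A list \<open>S\<close> of pairs \<open>(v, d)\<close> is adapted to the triple \<open>(e, h, f)\<close> if each \<open>v\<close> is a
  lowest weight vector generating a Jordan string of length \<open>d\<close>, and the strings together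
  form a basis of \<open>V\<close> that diagonalizes \<open>J\<close>.\<close>

definition adapted_strings ::
  "('v \<Rightarrow> 'v) \<Rightarrow> ('v \<Rightarrow> 'v) \<Rightarrow> ('v \<Rightarrow> 'v) \<Rightarrow> ('v \<times> nat) list \<Rightarrow> bool" where
  "adapted_strings e h f S \<longleftrightarrow>
     (\<forall>(v, d) \<in> set S. d > 0 \<and> f v = 0 \<and> h v = scale (- (of_nat d - 1)) v \<and> (e ^^ d) v = 0) \<and>
     (let bs = concat (map (jordan_string e) S) in
        distinct bs \<and> independent (set bs) \<and> span (set bs) = UNIV \<and> set bs \<subseteq> Va \<union> Vb)"

definition letter_of :: "'v \<Rightarrow> letter" where
  "letter_of v = (if v \<in> Va then LA else LB)"

text \<open>A diagram is the multiset of its rows, each row being read as a word in the two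
  letters: the Young diagram is determined by the lengths of the rows, and rows of equal
  length may be permuted. It does not depend on the adapted strings that are chosen.\<close>

definition ab_diagram :: "('v \<Rightarrow> 'v) \<Rightarrow> letter list multiset" where
  "ab_diagram e = (SOME D. \<exists>S. adapted_strings e (fst (triple_of e)) (snd (triple_of e)) S \<and>
     D = mset (map (\<lambda>s. map letter_of (jordan_string e s)) S))"

end

definition same_initial_letters :: "letter list multiset \<Rightarrow> bool" where
  "same_initial_letters D \<longleftrightarrow>
     (\<forall>d. \<forall>r. \<forall>s. r \<in># D \<and> s \<in># D \<and> length r = d \<and> length s = d \<longrightarrow> hd r = hd s)"

end

theory Submission
  imports Defs
begin

text \<open>
Every nilpotent \<open>e\<close> in \<open>p\<close> has a Jordan basis of \<open>J\<close>-homogeneous strings: a longest string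
\<open>v, e v, \<dots>\<close> is split off with the complement on which a functional not vanishing on the last vector
of the string, and all its composites with powers of \<open>e\<close>, vanish. This gives a normal triple. For
an arbitrary normal triple the same argument, with \<open>v\<close> a lowest weight vector and a weight
functional, produces strings adapted to the triple.

If two strings of the same length \<open>d\<close> start with different letters, then sending one to the other
is a nonzero nilpotent element of \<open>p(e,0)\<close>, and exchanging them is a non-nilpotent element of
\<open>p\<^sup>e\<close>. If all strings of length \<open>d\<close> start with the same letter, then \<open>J\<close> is scalar on the space
spanned by their initial vectors, which is a complement of \<open>ker e\<^sup>d\<^sup>-\<^sup>1 + e (ker e\<^sup>d\<^sup>+\<^sup>1)\<close> in
\<open>ker e\<^sup>d\<close>. Any \<open>y\<close> in \<open>p\<^sup>e\<close> anticommutes with \<open>J\<close>, so it acts by zero on this quotient; when this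
holds for all \<open>d\<close>, \<open>y\<close> is nilpotent, and \<open>y = 0\<close> if it also commutes with \<open>h\<close>.
\<close>

section \<open>String bases\<close>

context finite_dimensional_vector_space
begin

section \<open>Linear operators, functionals and operators diagonal on a basis\<close>

abbreviation lin :: "('b \<Rightarrow> 'b) \<Rightarrow> bool" where
  "lin \<equiv> Vector_Spaces.linear scale scale"

abbreviation functional :: "('b \<Rightarrow> 'a) \<Rightarrow> bool" where
  "functional \<equiv> Vector_Spaces.linear scale (*)"

lemma lin_add: "lin x \<Longrightarrow> x (u + v) = x u + x v"
  and lin_diff: "lin x \<Longrightarrow> x (u - v) = x u - x v"
  and lin_neg: "lin x \<Longrightarrow> x (- u) = - x u"
  and lin_zero: "lin x \<Longrightarrow> x 0 = 0"
  and lin_scale: "lin x \<Longrightarrow> x (scale c u) = scale c (x u)"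
  unfolding linear_iff_module_hom
  by (simp_all add: module_hom.add module_hom.diff module_hom.neg module_hom.zero module_hom.scale)

lemmas lin_simps = lin_add lin_diff lin_neg lin_zero lin_scale

lemma functional_add: "functional p \<Longrightarrow> p (u + v) = p u + p v"
  and functional_diff: "functional p \<Longrightarrow> p (u - v) = p u - p v"
  and functional_neg: "functional p \<Longrightarrow> p (- u) = - p u"
  and functional_zero: "functional p \<Longrightarrow> p 0 = 0"
  and functional_scale: "functional p \<Longrightarrow> p (scale c u) = c * p u"
  unfolding linear_iff_module_hom
  by (simp_all add: module_hom.add module_hom.diff module_hom.neg module_hom.zero module_hom.scale)

lemmas functional_simps =
  functional_add functional_diff functional_neg functional_zero functional_scale

lemma linI:
  "(\<And>u v. x (u + v) = x u + x v) \<Longrightarrow> (\<And>c u. x (scale c u) = scale c (x u)) \<Longrightarrow> lin x"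
  by (simp add: Vector_Spaces.linear_iff vector_space_axioms)

lemma functionalI:
  "(\<And>u v. p (u + v) = p u + p v) \<Longrightarrow> (\<And>c u. p (scale c u) = c * p u) \<Longrightarrow> functional p"
  by (simp add: Vector_Spaces.linear_iff vector_space_axioms)
    (simp add: vector_space_def algebra_simps)

lemma lin_funpow: "lin x \<Longrightarrow> lin (x ^^ n)"
  by (induction n) (auto intro!: linI simp: lin_simps)

lemma lin_lie_bracket: "lin x \<Longrightarrow> lin y \<Longrightarrow> lin (lie_bracket x y)"
  by (auto intro!: linI simp: lie_bracket_def lin_simps algebra_simps)

lemma exists_functional:
  assumes "z \<noteq> 0"
  obtains p where "functional p" "p z = 1"
proof -
  have ind: "independent {z}"
    using assms by simp
  let ?B = "extend_basis {z}"
  have B: "independent ?B" "span ?B = UNIV" "z \<in> ?B"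
    using independent_extend_basis[OF ind] span_extend_basis[OF ind] extend_basis_superset[OF ind]
    by auto
  show ?thesis
    using that[OF linear_representation[OF B(1,2), of z]] representation_basis[OF B(1,3)] by simp
qed

lemma lin_eq_on_basis:
  assumes "lin x" "lin y" "span B = UNIV" "\<And>b. b \<in> B \<Longrightarrow> x b = y b"
  shows "x = y"
proof
  fix v
  have "v \<in> span B"
    using assms(3) by simp
  then show "x v = y v"
    by (induction rule: span_induct_alt) (use assms in \<open>simp_all add: lin_simps\<close>)
qed

text \<open>An eigenvector of an operator that is diagonal on a basis only involves basis vectors with
  the same eigenvalue. Since the conclusion is again a statement about the span of an independent
  set, the lemma can be iterated over several diagonal operators.\<close>

lemma eigenvector_in_span:
  assumes B: "independent B" and x: "x \<in> span B" and T: "lin T"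
    and diag: "\<And>b. b \<in> B \<Longrightarrow> \<exists>c. T b = scale c b" and Tx: "T x = scale a x"
  shows "x \<in> span {b \<in> B. T b = scale a b}"
proof -
  obtain c where c: "\<And>b. b \<in> B \<Longrightarrow> T b = scale (c b) b"
    using diag by metis
  have T_span: "T y \<in> span B" if "y \<in> span B" for y
    using that
  proof (induction rule: span_induct_alt)
    case (step k b y)
    then show ?case
      using c by (simp add: lin_simps[OF T] span_add span_scale span_base)
  qed (simp add: lin_zero[OF T] span_zero)
  \<comment> \<open>In coordinates \<open>T\<close> multiplies the entry at \<open>b\<close> by
    \<open>c b\<close>, so \<open>T x = scale a x\<close> forces \<open>c b = a\<close> wherever
    \<open>x\<close> has a nonzero entry. Membership in the span is carried through the induction
    because \<open>representation\<close> is additive only there.\<close>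
  have rep: "representation B (T y) b = c b * representation B y b" if "y \<in> span B" "b \<in> B" for y b
  proof -
    have "y \<in> span B \<and> representation B (T y) b = c b * representation B y b"
      using that(1)
    proof (induction rule: span_induct_alt)
      case base
      then show ?case
        by (simp add: lin_zero[OF T] representation_zero span_zero)
    next
      case (step k b' y)
      have "representation B (T b') b = c b * representation B b' b"
        using c[OF step(1)] representation_basis[OF B step(1)] span_base[OF step(1)]
        by (simp add: representation_scale[OF B])
      with step T_span show ?case
        by (simp add: lin_simps[OF T] representation_add[OF B] representation_scale[OF B]
            span_base span_scale span_add algebra_simps)
    qed
    then show ?thesis ..
  qed
  have "scale (representation B x b) b \<in> span {b \<in> B. T b = scale a b}"
    if "representation B x b \<noteq> 0" for b
  proof -
    have b: "b \<in> B"
      using that representation_ne_zero by blast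
    have "c b = a"
      using rep[OF x b] that Tx x by (simp add: representation_scale[OF B])
    with c[OF b] b show ?thesis
      by (intro span_scale span_base) auto
  qed
  then have "(\<Sum>b | representation B x b \<noteq> 0. scale (representation B x b) b)
      \<in> span {b \<in> B. T b = scale a b}"
    by (intro span_sum) auto
  then show ?thesis
    by (simp add: sum_nonzero_representation_eq[OF B x])
qed

lemma scale_2: "scale 2 x = x + x"
  using scale_left_distrib[of 1 1 x] by simp

lemma independent_nonzero: "independent B \<Longrightarrow> b \<in> B \<Longrightarrow> b \<noteq> 0"
  using dependent_zero by blast

section \<open>Bases consisting of Jordan strings\<close>

definition string_vectors :: "('b \<Rightarrow> 'b) \<Rightarrow> ('b \<times> nat) list \<Rightarrow> 'b list" where
  "string_vectors e S = concat (map (jordan_string e) S)"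

lemma string_vectors_simps [simp]:
  "string_vectors e [] = []"
  "string_vectors e (s # S) = jordan_string e s @ string_vectors e S"
  by (simp_all add: string_vectors_def)

lemma set_jordan_string: "set (jordan_string e (v, d)) = (\<lambda>i. (e ^^ i) v) ` {..<d}"
  by (auto simp: jordan_string_def)

lemma set_string_vectors:
  "set (string_vectors e S) = {(e ^^ i) v | v d i. (v, d) \<in> set S \<and> i < d}"
proof (induction S)
  case (Cons s S)
  then show ?case
    by (cases s) (auto simp: set_jordan_string)
qed simp

text \<open>The condition \<open>(e ^^ d) v = 0\<close> closes every string under \<open>e\<close>,
  so that the lengths \<open>d\<close> are the Jordan block sizes of \<open>e\<close> on
  \<open>W\<close>.\<close>

definition string_basis :: "('b \<Rightarrow> 'b) \<Rightarrow> ('b \<times> nat) list \<Rightarrow> 'b set \<Rightarrow> bool" where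
  "string_basis e S W \<longleftrightarrow> distinct (string_vectors e S) \<and> independent (set (string_vectors e S)) \<and>
     span (set (string_vectors e S)) = W \<and> (\<forall>(v, d) \<in> set S. d > 0 \<and> (e ^^ d) v = 0)"

text \<open>Distinctness of the listed vectors makes a prescription indexed by string and position
  well defined as a function of the vector.\<close>

lemma string_function_exists:
  assumes "distinct (string_vectors e S)"
  shows "\<exists>G. \<forall>(v, d) \<in> set S. \<forall>i<d. G ((e ^^ i) v) = F v d i"
  using assms
proof (induction S)
  case Nil
  then show ?case by simp
next
  case (Cons s S)
  obtain w n where s: "s = (w, n)"
    by fastforce
  from Cons obtain G where G: "\<And>v d i. (v, d) \<in> set S \<Longrightarrow> i < d \<Longrightarrow> G ((e ^^ i) v) = F v d i"
    by fastforce
  let ?js = "jordan_string e (w, n)"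
  have inj: "inj_on (\<lambda>i. (e ^^ i) w) {..<n}"
    using Cons.prems by (simp add: s jordan_string_def distinct_map lessThan_atLeast0)
  define G' where "G' b = (if b \<in> set ?js then F w n (inv_into {..<n} (\<lambda>i. (e ^^ i) w) b) else G b)" for b
  have "G' ((e ^^ i) v) = F v d i" if "(v, d) \<in> set (s # S)" "i < d" for v d i
  proof (cases "(v, d) = (w, n)")
    case True
    then show ?thesis
      using that(2) by (auto simp: G'_def set_jordan_string inv_into_f_f[OF inj])
  next
    case False
    with that have vd: "(v, d) \<in> set S"
      by (auto simp: s)
    with that(2) have "(e ^^ i) v \<in> set (string_vectors e S)"
      by (auto simp: set_string_vectors)
    with Cons.prems have "(e ^^ i) v \<notin> set ?js"
      by (auto simp: s)
    with G[OF vd that(2)] show ?thesis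
      by (simp add: G'_def)
  qed
  then show ?case
    by blast
qed

text \<open>Source of the operators built below: \<open>f\<close> of a normal triple, and the
  elements of the centralizer that carry one string to another.\<close>

lemma string_linear_exists:
  assumes "string_basis e S W"
  obtains g where "lin g" "\<And>v d i. (v, d) \<in> set S \<Longrightarrow> i < d \<Longrightarrow> g ((e ^^ i) v) = F v d i"
proof -
  obtain G where G: "\<And>v d i. (v, d) \<in> set S \<Longrightarrow> i < d \<Longrightarrow> G ((e ^^ i) v) = F v d i"
    using string_function_exists[of e S F] assms unfolding string_basis_def by fast
  interpret vector_space_pair scale scale
    by unfold_locales
  obtain g where g: "lin g" "\<forall>x \<in> set (string_vectors e S). g x = G x"
    using linear_independent_extend[of "set (string_vectors e S)" G] assms
    unfolding string_basis_def by blast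
  from g(1) show ?thesis
  proof
    fix v d i
    assume vd: "(v, d) \<in> set S" "i < d"
    then have "(e ^^ i) v \<in> set (string_vectors e S)"
      by (auto simp: set_string_vectors)
    then show "g ((e ^^ i) v) = F v d i"
      using g(2) G[OF vd] by simp
  qed
qed

lemma string_lin_eqI:
  assumes "string_basis e S UNIV" "lin x" "lin y"
    and "\<And>v d i. (v, d) \<in> set S \<Longrightarrow> i < d \<Longrightarrow> x ((e ^^ i) v) = y ((e ^^ i) v)"
  shows "x = y"
  using assms(1) by (intro lin_eq_on_basis[OF assms(2,3), of "set (string_vectors e S)"])
    (auto simp: string_basis_def set_string_vectors assms(4))

text \<open>The functional detects the last vector of the string, so that the pairing of the
  functionals \<open>p \<circ> e ^^ k\<close> with the string is antitriangular; the vectors of the string are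
  adjoined to a basis of the complement starting from the last one.\<close>

lemma string_basis_Cons:
  assumes e: "lin e" and p: "functional p" and d: "d > 0"
    and W: "subspace W" "\<And>x. x \<in> W \<Longrightarrow> e x \<in> W" "\<And>x. x \<in> W \<Longrightarrow> (e ^^ d) x = 0"
    and v: "v \<in> W" "p ((e ^^ (d - 1)) v) \<noteq> 0"
    and S: "string_basis e S {u \<in> W. \<forall>k. p ((e ^^ k) u) = 0}"
  shows "string_basis e ((v, d) # S) W"
proof -
  \<comment> \<open>\<open>bs i\<close> adjoins only the part of the new string from position
    \<open>i\<close> on.\<close>
  define bs where "bs i = map (\<lambda>j. (e ^^ j) v) [i..<d] @ string_vectors e S" for i
  have eW: "(e ^^ j) x \<in> W" if "x \<in> W" for x j
    using that by (induction j) (auto intro: W)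
  have kill: "(e ^^ k) x = 0" if "x \<in> W" "d \<le> k" for k x
  proof -
    have "(e ^^ k) x = (e ^^ (k - d)) ((e ^^ d) x)"
      using that by (simp flip: funpow_add comp_apply[of "e ^^ (k - d)"])
    then show ?thesis
      using that W lin_zero[OF lin_funpow[OF e]] by simp
  qed
  note ek = lin_simps[OF lin_funpow[OF e]]
  \<comment> \<open>Once the last \<open>n\<close> vectors of the string are adjoined, the span is
    cut out of \<open>W\<close> by the functionals \<open>p \<circ> e ^^ k\<close> with
    \<open>k \<ge> n\<close>: the given complement for \<open>n = 0\<close>, all of \<open>W\<close>
    for \<open>n = d\<close>.\<close>
  have "distinct (bs (d - n)) \<and> independent (set (bs (d - n))) \<and>
      span (set (bs (d - n))) = {u \<in> W. \<forall>k\<ge>n. p ((e ^^ k) u) = 0}" if "n \<le> d" for n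
    using that
  proof (induction n)
    case 0
    then show ?case
      using S by (auto simp: string_basis_def bs_def)
  next
    case (Suc n)
    define i where "i = d - Suc n"
    have i: "i < d" "d - n = Suc i" "i + n = d - 1"
      using Suc.prems by (auto simp: i_def)
    let ?w = "(e ^^ i) v"
    have w: "p ((e ^^ n) ?w) \<noteq> 0" "?w \<in> W"
      using v i eW by (auto simp flip: funpow_add comp_apply[of "e ^^ n"] simp: add.commute)
    have w0: "(e ^^ k) ?w = 0" if "k \<ge> Suc n" for k
    proof -
      have "(e ^^ k) ?w = (e ^^ (k + i)) v"
        by (simp add: funpow_add)
      then show ?thesis
        using kill[OF v(1), of "k + i"] that i by simp
    qed
    have IH: "distinct (bs (Suc i))" "independent (set (bs (Suc i)))"
      "span (set (bs (Suc i))) = {u \<in> W. \<forall>k\<ge>n. p ((e ^^ k) u) = 0}"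
      using Suc i by auto
    have bs: "bs i = ?w # bs (Suc i)"
      using i by (simp add: bs_def upt_conv_Cons)
    have nin: "?w \<notin> span (set (bs (Suc i)))"
      using w IH by auto
    have "x \<in> span (insert ?w (set (bs (Suc i)))) \<longleftrightarrow> x \<in> W \<and> (\<forall>k\<ge>Suc n. p ((e ^^ k) x) = 0)" for x
    proof
      assume "x \<in> span (insert ?w (set (bs (Suc i))))"
      then obtain c where c: "x - scale c ?w \<in> W" "\<And>k. k \<ge> n \<Longrightarrow> p ((e ^^ k) (x - scale c ?w)) = 0"
        using IH by (auto simp: span_breakdown_eq)
      have "x = (x - scale c ?w) + scale c ?w"
        by simp
      then have "x \<in> W"
        using c w W(1) by (metis subspace_add subspace_scale)
      moreover have "p ((e ^^ k) x) = 0" if "k \<ge> Suc n" for k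
        using c(2)[of k] w0[OF that] that by (simp add: ek functional_simps[OF p])
      ultimately show "x \<in> W \<and> (\<forall>k\<ge>Suc n. p ((e ^^ k) x) = 0)"
        by blast
    next
      assume x: "x \<in> W \<and> (\<forall>k\<ge>Suc n. p ((e ^^ k) x) = 0)"
      \<comment> \<open>Subtracting this multiple of \<open>?w\<close> cancels the value of
        \<open>p \<circ> e ^^ n\<close>; the functionals with larger \<open>k\<close> already vanish
        on \<open>?w\<close>.\<close>
      define c where "c = p ((e ^^ n) x) / p ((e ^^ n) ?w)"
      have "x - scale c ?w \<in> W"
        using x w W(1) by (simp add: subspace_diff subspace_scale)
      moreover have "p ((e ^^ k) (x - scale c ?w)) = 0" if "k \<ge> n" for k
      proof (cases "k = n")
        case True
        then show ?thesis
          using w by (simp add: ek functional_simps[OF p] c_def)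
      next
        case False
        then show ?thesis
          using that x w0[of k] by (simp add: ek functional_simps[OF p])
      qed
      ultimately show "x \<in> span (insert ?w (set (bs (Suc i))))"
        using IH by (auto simp: span_breakdown_eq)
    qed
    then have "span (set (bs i)) = {u \<in> W. \<forall>k\<ge>Suc n. p ((e ^^ k) u) = 0}"
      by (auto simp: bs)
    moreover have "distinct (bs i)" "independent (set (bs i))"
      using IH(1,2) nin span_base[of ?w] independent_insertI[OF nin] unfolding bs by auto
    ultimately show ?case
      by (simp add: i_def)
  qed
  from this[of d] have "distinct (bs 0)" "independent (set (bs 0))" "span (set (bs 0)) = W"
    using kill functional_zero[OF p] by auto
  moreover have "bs 0 = string_vectors e ((v, d) # S)"
    by (simp add: bs_def jordan_string_def)
  ultimately show ?thesis
    using S d v W by (auto simp: string_basis_def)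
qed

text \<open>Induction on the dimension, splitting off one string at a time. \<open>P\<close> is the
  stability that the complement has to inherit, \<open>Q\<close> the property demanded of initial
  vectors. It is applied first with \<open>e\<close> and \<open>J\<close> alone, to construct a
  triple, and then with a whole triple and \<open>J\<close>.\<close>

lemma string_decomposition:
  assumes e: "lin e"
    and stable: "\<And>W x. P W \<Longrightarrow> x \<in> W \<Longrightarrow> e x \<in> W"
    and split: "\<And>W. subspace W \<Longrightarrow> P W \<Longrightarrow> W \<noteq> {0} \<Longrightarrow>
      \<exists>v d p. v \<in> W \<and> Q v d \<and> d > 0 \<and> functional p \<and> (\<forall>x\<in>W. (e ^^ d) x = 0) \<and>
        p ((e ^^ (d - 1)) v) \<noteq> 0 \<and> P {u \<in> W. \<forall>k. p ((e ^^ k) u) = 0}"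
    and W: "subspace W" "P W"
  shows "\<exists>S. string_basis e S W \<and> (\<forall>(v, d) \<in> set S. Q v d)"
  using W
proof (induction "dim W" arbitrary: W rule: less_induct)
  case less
  show ?case
  proof (cases "W = {0}")
    case True
    then have "string_basis e [] W"
      by (simp add: string_basis_def independent_empty)
    then show ?thesis
      by fastforce
  next
    case False
    obtain v d p where v: "v \<in> W" "Q v d" "d > 0" "functional p" "\<And>x. x \<in> W \<Longrightarrow> (e ^^ d) x = 0"
        "p ((e ^^ (d - 1)) v) \<noteq> 0" and PU: "P {u \<in> W. \<forall>k. p ((e ^^ k) u) = 0}" (is "P ?U")
      using split[OF less.prems False] by blast
    have U: "subspace ?U"
      using less.prems(1) v(4)
      by (auto simp: subspace_def lin_simps[OF lin_funpow[OF e]] functional_simps)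
    \<comment> \<open>\<open>v\<close> lies outside the complement, by the functional with
      \<open>k = d - 1\<close>.\<close>
    have "?U \<subset> W"
      using v(1,6) by blast
    then have "dim ?U < dim W"
      using U less.prems(1) by (intro dim_psubset) (simp add: span_eq_iff[THEN iffD2])
    from less.hyps[OF this U PU] obtain S where S: "string_basis e S ?U" "\<forall>(v, d) \<in> set S. Q v d"
      by blast
    have "string_basis e ((v, d) # S) W"
      using v S less.prems by (intro string_basis_Cons[OF e v(4)] stable) auto
    then show ?thesis
      using S(2) v(2) by fastforce
  qed
qed

end

section \<open>Strings in representations of sl(2)\<close>

locale sl2_triple = finite_dimensional_vector_space scale Basis
  for scale :: "'k::field_char_0 \<Rightarrow> 'v::ab_group_add \<Rightarrow> 'v" (infixr \<open>*s\<close> 75)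
    and Basis :: "'v set" +
  fixes e h f :: "'v \<Rightarrow> 'v"
  assumes lin_e: "lin e" and lin_h: "lin h" and lin_f: "lin f"
    and h_e: "h (e v) = e (h v) + 2 *s e v"
    and h_f: "h (f v) = f (h v) - 2 *s f v"
    and e_f: "e (f v) = f (e v) + h v"
begin

section \<open>Commutation relations with powers of \<open>e\<close> and \<open>f\<close>\<close>

lemmas e_pow_simps = lin_simps[OF lin_funpow[OF lin_e]]
  and f_pow_simps = lin_simps[OF lin_funpow[OF lin_f]]

lemma h_e_pow: "h ((e ^^ k) v) = (e ^^ k) (h v) + of_nat (2 * k) *s (e ^^ k) v"
  by (induction k) (simp_all add: h_e lin_simps[OF lin_e] algebra_simps scale_2)

lemma f_e_pow: "f ((e ^^ Suc k) v) = (e ^^ Suc k) (f v) - of_nat (Suc k) *s (e ^^ k) (h v + of_nat k *s v)"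
proof (induction k arbitrary: v)
  case 0
  then show ?case
    by (simp add: e_f)
next
  case (Suc k)
  have "f ((e ^^ Suc (Suc k)) v) = f ((e ^^ Suc k) (e v))"
    by (simp only: funpow_Suc_right o_apply)
  also have "\<dots> = (e ^^ Suc k) (f (e v)) - of_nat (Suc k) *s (e ^^ k) (h (e v) + of_nat k *s e v)"
    by (rule Suc)
  also have "f (e v) = e (f v) - h v"
    by (simp add: e_f)
  also have "h (e v) + of_nat k *s e v = e (h v + of_nat (k + 2) *s v)"
    by (simp add: h_e lin_simps[OF lin_e] algebra_simps scale_2)
  also have "(e ^^ Suc k) (e (f v) - h v) - of_nat (Suc k) *s (e ^^ k) (e (h v + of_nat (k + 2) *s v))
      = (e ^^ Suc (Suc k)) (f v) - of_nat (Suc (Suc k)) *s (e ^^ Suc k) (h v + of_nat (Suc k) *s v)"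
  proof -
    have scalars: "a - b - of_nat (Suc k) *s (b + of_nat (k + 2) *s c)
        = a - of_nat (Suc (Suc k)) *s (b + of_nat (Suc k) *s c)" for a b c
    proof -
      have "of_nat (Suc (Suc k)) *s b = b + of_nat (Suc k) *s b"
        by (simp only: of_nat_Suc[of "Suc k"] scale_left_distrib scale_one)
      moreover have "of_nat (Suc k) * of_nat (k + 2) = of_nat (Suc (Suc k)) * (of_nat (Suc k) :: 'k)"
        by (simp only: of_nat_mult[symmetric]) (simp add: mult.commute)
      ultimately show ?thesis
        by (simp only: scale_right_distrib scale_scale) (simp only: diff_diff_add add.assoc)
    qed
    show ?thesis
      unfolding funpow_Suc_right o_apply
      by (simp only: e_pow_simps lin_simps[OF lin_e] scalars)
  qed
  finally show ?case .
qed

text \<open>The Chevalley involution: every identity for powers of \<open>e\<close> yields its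
  mirror image for powers of \<open>f\<close>, with lowest weights turned into highest ones.\<close>

lemma swap: "sl2_triple scale Basis f (\<lambda>v. - h v) e"
proof (intro sl2_triple.intro sl2_triple_axioms.intro finite_dimensional_vector_space_axioms)
  show "lin (\<lambda>v. - h v)"
    by (auto intro!: linI simp: lin_simps[OF lin_h])
qed (simp_all add: lin_e lin_f h_e h_f e_f lin_simps[OF lin_e] lin_simps[OF lin_f])

lemma h_f_pow: "h ((f ^^ k) v) = (f ^^ k) (h v) - of_nat (2 * k) *s (f ^^ k) v"
proof -
  have "- h ((f ^^ k) v) = (f ^^ k) (- h v) + of_nat (2 * k) *s (f ^^ k) v"
    by (rule sl2_triple.h_e_pow[OF swap])
  then have "- h ((f ^^ k) v) = - ((f ^^ k) (h v) - of_nat (2 * k) *s (f ^^ k) v)"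
    by (simp add: f_pow_simps)
  then show ?thesis
    by (simp only: neg_equal_iff_equal)
qed

lemma e_f_pow: "e ((f ^^ Suc k) v) = (f ^^ Suc k) (e v) + of_nat (Suc k) *s (f ^^ k) (h v - of_nat k *s v)"
proof -
  have "(f ^^ k) (- h v + of_nat k *s v) = - (f ^^ k) (h v - of_nat k *s v)"
    by (simp add: f_pow_simps)
  then show ?thesis
    using sl2_triple.f_e_pow[OF swap, of k v]
    by (simp only: scale_minus_right diff_minus_eq_add)
qed

lemma f_e_pow_lowest:
  assumes "f v = 0" "h v = - a *s v"
  shows "f ((e ^^ Suc k) v) = (of_nat (Suc k) * (a - of_nat k)) *s (e ^^ k) v"
proof -
  have "h v + of_nat k *s v = - ((a - of_nat k) *s v)"
    using assms by (simp add: algebra_simps)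
  then show ?thesis
    unfolding f_e_pow using assms(1) by (simp only: e_pow_simps scale_scale scale_minus_right diff_minus_eq_add add_0)
qed

lemma e_f_pow_highest:
  assumes "e v = 0" "h v = a *s v"
  shows "e ((f ^^ Suc k) v) = (of_nat (Suc k) * (a - of_nat k)) *s (f ^^ k) v"
  using sl2_triple.f_e_pow_lowest[OF swap, of v a k] assms by simp

text \<open>Each application of \<open>f\<close> contributes a factor \<open>Suc j * (n - j)\<close>
  with \<open>j < n\<close>, which is nonzero in characteristic \<open>0\<close>.\<close>

lemma f_pow_e_pow_lowest:
  assumes v: "f v = 0" "h v = - of_nat n *s v" and "k \<le> i" "i \<le> n"
  shows "\<exists>c. c \<noteq> 0 \<and> (f ^^ k) ((e ^^ i) v) = c *s (e ^^ (i - k)) v"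
  using assms(3)
proof (induction k)
  case 0
  then show ?case
    by (auto intro!: exI[of _ 1])
next
  case (Suc k)
  then obtain c where c: "c \<noteq> 0" "(f ^^ k) ((e ^^ i) v) = c *s (e ^^ (i - k)) v"
    by auto
  define j where "j = i - Suc k"
  have j: "i - k = Suc j" "j < n"
    using Suc.prems assms by (auto simp: j_def)
  have "(f ^^ Suc k) ((e ^^ i) v) = (c * (of_nat (Suc j) * (of_nat n - of_nat j))) *s (e ^^ j) v"
    using c f_e_pow_lowest[OF v, of j] j by (simp add: lin_simps[OF lin_f])
  moreover have "of_nat n - of_nat j \<noteq> (0 :: 'k)"
    using j by simp
  moreover have "of_nat (Suc j) \<noteq> (0 :: 'k)"
    by (simp only: of_nat_eq_0_iff)
  ultimately show ?case
    using c by (metis j_def mult_eq_0_iff)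
qed

lemma e_pow_f_pow_highest:
  assumes "e v = 0" "h v = of_nat n *s v" and "k \<le> i" "i \<le> n"
  shows "\<exists>c. c \<noteq> 0 \<and> (e ^^ k) ((f ^^ i) v) = c *s (f ^^ (i - k)) v"
  using sl2_triple.f_pow_e_pow_lowest[OF swap, of v n k i] assms by simp

section \<open>Extreme weights on a stable subspace where \<open>e ^^ Suc m\<close> vanishes\<close>

context
  fixes W :: "'v set" and m :: nat
  assumes stable: "\<forall>x\<in>W. e x \<in> W \<and> f x \<in> W" and top: "\<forall>x\<in>W. (e ^^ Suc m) x = 0"
begin

lemma e_in: "x \<in> W \<Longrightarrow> e x \<in> W"
  and f_in: "x \<in> W \<Longrightarrow> f x \<in> W"
  and e_top: "x \<in> W \<Longrightarrow> (e ^^ Suc m) x = 0"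
  using stable top by blast+

lemma e_pow_in: "x \<in> W \<Longrightarrow> (e ^^ k) x \<in> W"
  by (induction k) (auto intro: e_in)

lemma f_pow_in: "x \<in> W \<Longrightarrow> (f ^^ k) x \<in> W"
  by (induction k) (auto intro: f_in)

text \<open>In \<open>f_e_pow\<close> with \<open>k = m\<close> both terms containing
  \<open>e ^^ Suc m\<close> vanish, as \<open>x\<close> and \<open>f x\<close> lie in
  \<open>W\<close>; a nonzero multiple of the claim remains. So \<open>e ^^ m\<close> detects only
  the weight \<open>- m\<close>.\<close>

lemma e_pow_h_top: "x \<in> W \<Longrightarrow> (e ^^ m) (h x + of_nat m *s x) = 0"
  using f_e_pow[of m x] e_top[of x] e_top[of "f x"] f_in[of x]
  by (auto simp: lin_simps[OF lin_f] simp del: funpow.simps of_nat_Suc)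

lemma top_highest:
  assumes "x \<in> W"
  shows "e ((e ^^ m) x) = 0" "h ((e ^^ m) x) = of_nat m *s (e ^^ m) x"
proof -
  show "e ((e ^^ m) x) = 0"
    using e_top[OF assms] by simp
  have "(e ^^ m) (h x) = - (of_nat m *s (e ^^ m) x)"
    using e_pow_h_top[OF assms] by (simp add: e_pow_simps eq_neg_iff_add_eq_0)
  then show "h ((e ^^ m) x) = of_nat m *s (e ^^ m) x"
    by (simp only: h_e_pow mult_2 of_nat_add scale_left_distrib) simp
qed

text \<open>The coefficient in \<open>e_f_pow_highest\<close> vanishes only at \<open>k = m\<close>;
  past \<open>f ^^ Suc m\<close>, applying \<open>e\<close> undoes \<open>f\<close> up to a nonzero
  factor. Hence it is enough that \<open>(e ^^ j) ((f ^^ (Suc m + j)) z) = 0\<close> for one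
  \<open>j\<close>, and \<open>j = Suc m\<close> will do.\<close>

lemma f_pow_top:
  assumes z: "z \<in> W" "e z = 0" "h z = of_nat m *s z"
  shows "(f ^^ Suc m) z = 0"
proof -
  have "(f ^^ Suc m) z = 0" if "(e ^^ j) ((f ^^ (Suc m + j)) z) = 0" for j
    using that
  proof (induction j)
    case (Suc j)
    have "(e ^^ Suc j) ((f ^^ (Suc m + Suc j)) z) = (e ^^ j) (e ((f ^^ Suc (Suc m + j)) z))"
      by (simp only: funpow_Suc_right o_apply add_Suc_right)
    also have "\<dots> = (of_nat (Suc (Suc m + j)) * (of_nat m - of_nat (Suc m + j)))
        *s (e ^^ j) ((f ^^ (Suc m + j)) z)"
      unfolding e_f_pow_highest[OF z(2,3)] by (simp only: e_pow_simps)
    finally have "(of_nat (Suc (Suc m + j)) * (of_nat m - of_nat (Suc m + j)))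
        *s (e ^^ j) ((f ^^ (Suc m + j)) z) = 0"
      using Suc.prems by simp
    moreover have "of_nat m - of_nat (Suc m + j) \<noteq> (0 :: 'k)"
      unfolding right_minus_eq of_nat_eq_iff by simp
    moreover have "of_nat (Suc (Suc m + j)) \<noteq> (0 :: 'k)"
      by (simp only: of_nat_eq_0_iff)
    ultimately show ?case
      using Suc.IH unfolding scale_eq_0_iff mult_eq_0_iff by blast
  qed simp
  then show ?thesis
    using e_top f_pow_in z(1) by metis
qed

text \<open>In terms of weights: \<open>e ^^ m\<close> detects only the weight \<open>- m\<close>,
  and \<open>f ^^ Suc m\<close> reaches it only from the weight \<open>m + 2\<close>, which is
  absent. Induction on an exponent \<open>j\<close> with \<open>(e ^^ j) x = 0\<close> replaces the
  decomposition into weight spaces; passing from \<open>x\<close> to \<open>e x\<close> raises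
  \<open>k\<close> by one.\<close>

lemma e_pow_f_pow_top:
  assumes "x \<in> W"
  shows "(e ^^ m) ((f ^^ Suc m) x) = 0"
proof -
  have "(e ^^ m) ((f ^^ (Suc m + k)) x) = 0" if "(e ^^ j) x = 0" "x \<in> W" for j k x
    using that
  proof (induction j arbitrary: x k)
    case 0
    then show ?case
      by (simp add: f_pow_simps e_pow_simps lin_simps[OF lin_f])
  next
    case (Suc j)
    define n where "n = Suc m + k"
    define y where "y = (f ^^ n) x"
    have y: "y \<in> W"
      using f_pow_in Suc.prems by (simp add: y_def)
    have "0 = (e ^^ m) ((f ^^ Suc n) (e x))"
      using Suc.IH[of "e x" "Suc k"] Suc.prems e_in
      by (simp add: n_def funpow_swap1)
    also have "(f ^^ Suc n) (e x) = e (f y) - of_nat (Suc n) *s (f ^^ n) (h x - of_nat n *s x)"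
      using e_f_pow[of n x] by (simp add: y_def)
    \<comment> \<open>The coefficient \<open>n\<close> is split as \<open>m + Suc k\<close>, so that
      \<open>e_pow_h_top\<close> removes the first part and a nonzero multiple of
      \<open>(e ^^ m) y\<close> is left.\<close>
    also have "(f ^^ n) (h x - of_nat n *s x) = (h y + of_nat m *s y) + of_nat (Suc k) *s y"
    proof -
      have "(f ^^ n) (h x) = h y + of_nat (2 * n) *s y"
        by (simp add: y_def h_f_pow)
      moreover have "of_nat (2 * n) - of_nat n = (of_nat m + of_nat (Suc k) :: 'k)"
        by (simp add: n_def)
      ultimately show ?thesis
        by (simp add: f_pow_simps y_def[symmetric] add.assoc
            flip: scale_left_distrib scale_left_diff_distrib add_diff_eq)
    qed
    also have "(e ^^ m) (e (f y) - of_nat (Suc n) *s ((h y + of_nat m *s y) + of_nat (Suc k) *s y)) =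
        - (of_nat (Suc n) * of_nat (Suc k)) *s (e ^^ m) y"
    proof -
      have "(e ^^ m) (e (f y)) = 0"
        using e_top[OF f_in[OF y]] by (simp add: funpow_swap1)
      then show ?thesis
        using e_pow_h_top[OF y] unfolding e_pow_simps by (simp del: of_nat_Suc)
    qed
    finally have "(of_nat (Suc n) * of_nat (Suc k)) *s (e ^^ m) y = 0"
      by simp
    then have "(e ^^ m) y = 0"
      by (simp only: scale_eq_0_iff mult_eq_0_iff of_nat_eq_0_iff) simp
    then show ?case
      by (simp add: y_def n_def)
  qed
  from this[of "Suc m" x 0] show ?thesis
    using e_top[OF assms] assms by simp
qed

end

end

section \<open>Normal triples and adapted strings\<close>

context endomorphisms
begin

section \<open>The trace in the fixed basis\<close>

lemma endo_trace_comp_commute: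
  assumes x: "lin x" and y: "lin y"
  shows "endo_trace (x \<circ> y) = endo_trace (y \<circ> x)"
proof -
  have expand: "representation Basis (x (y b)) b =
      (\<Sum>c\<in>Basis. representation Basis (y b) c * representation Basis (x c) b)"
    if x: "lin x" for x y :: "'v \<Rightarrow> 'v" and b
  proof -
    have "y b = (\<Sum>c\<in>Basis. scale (representation Basis (y b) c) c)"
      using sum_representation_eq[OF independent_Basis, of "y b" Basis] finite_Basis span_Basis
      by simp
    then have "x (y b) = (\<Sum>c\<in>Basis. scale (representation Basis (y b) c) (x c))"
      using module_hom.sum[OF x[unfolded linear_iff_module_hom], of "\<lambda>c. scale (representation Basis (y b) c) c" Basis]
      by (simp add: lin_scale[OF x])
    then show ?thesis
      using span_Basis independent_Basis
      by (simp add: representation_sum representation_scale)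
  qed
  have "endo_trace (x \<circ> y) = (\<Sum>b\<in>Basis. \<Sum>c\<in>Basis. representation Basis (y b) c * representation Basis (x c) b)"
    by (simp add: endo_trace_def expand[OF x])
  also have "\<dots> = (\<Sum>c\<in>Basis. \<Sum>b\<in>Basis. representation Basis (x c) b * representation Basis (y b) c)"
    by (subst sum.swap) (simp add: mult.commute)
  also have "\<dots> = endo_trace (y \<circ> x)"
    by (simp add: endo_trace_def expand[OF y])
  finally show ?thesis .
qed

lemma endo_trace_uminus: "endo_trace (\<lambda>v. - x v) = - endo_trace x"
  using representation_neg[OF independent_Basis] span_Basis
  by (simp add: endo_trace_def sum_negf)

lemma endo_trace_diff: "endo_trace (\<lambda>v. x v - y v) = endo_trace x - endo_trace y"
  using representation_diff[OF independent_Basis] span_Basis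
  by (simp add: endo_trace_def sum_subtractf)

end

context AIII
begin

section \<open>The involution \<open>J\<close> and its relation to \<open>p\<close> and
  \<open>k\<close>\<close>

lemma J_J [simp]: "J (J v) = v"
  using J_involution by (simp add: pointfree_idE)

lemma inv_J: "inv J = J"
  by (rule inv_equality) simp_all

lemmas J_simps = lin_simps[OF J_linear]

lemma theta_eq_iff: "theta x = (\<lambda>v. - x v) \<longleftrightarrow> (\<forall>v. J (x v) = - x (J v))"
proof -
  have "theta x = (\<lambda>v. - x v) \<longleftrightarrow> (\<forall>v. J (x (J v)) = - x v)"
    by (auto simp: theta_def inv_J fun_eq_iff)
  also have "\<dots> \<longleftrightarrow> (\<forall>v. J (x v) = - x (J v))"
    by (metis J_J)
  finally show ?thesis .
qed

text \<open>The trace condition is automatic, since \<open>x\<close> and \<open>- x\<close> are conjugate.\<close>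

lemma pp_iff: "x \<in> pp \<longleftrightarrow> lin x \<and> (\<forall>v. J (x v) = - x (J v))"
proof -
  have "endo_trace x = 0" if x: "lin x" and "\<forall>v. J (x v) = - x (J v)"
  proof -
    have "lin (\<lambda>v. J (x v))"
      by (intro linI) (simp_all add: lin_simps[OF x] J_simps)
    then have "endo_trace (J \<circ> (\<lambda>v. J (x v))) = endo_trace ((\<lambda>v. J (x v)) \<circ> J)"
      by (intro endo_trace_comp_commute J_linear)
    moreover have "J \<circ> (\<lambda>v. J (x v)) = x"
      by (simp add: fun_eq_iff)
    moreover have "(\<lambda>v. J (x v)) \<circ> J = (\<lambda>v. - x v)"
      using that(2) by (simp add: fun_eq_iff)
    ultimately have "endo_trace x = - endo_trace x"
      by (simp add: endo_trace_uminus)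
    then show ?thesis
      by simp
  qed
  then show ?thesis
    by (auto simp: pp_def sl_def theta_eq_iff)
qed

lemma
  assumes "x \<in> pp"
  shows pp_lin: "lin x" and pp_J: "J (x v) = - x (J v)"
  using assms by (simp_all add: pp_iff)

lemma J_pow:
  assumes "x \<in> pp"
  shows "J ((x ^^ k) v) = scale ((- 1) ^ k) ((x ^^ k) (J v))"
  by (induction k) (simp_all add: pp_J[OF assms] lin_simps[OF pp_lin[OF assms]])

lemma pow_J:
  assumes "x \<in> pp"
  shows "(x ^^ k) (J v) = scale ((- 1) ^ k) (J ((x ^^ k) v))"
proof -
  have "(- 1) ^ k * (- 1) ^ k = (1 :: 'k)"
    by (simp flip: power_mult_distrib)
  then show ?thesis
    by (simp add: J_pow[OF assms])
qed

lemma lie_bracket_in_kk: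
  assumes "x \<in> pp" "y \<in> pp"
  shows "lie_bracket x y \<in> kk"
proof -
  note lin = pp_lin[OF assms(1)] pp_lin[OF assms(2)]
  have "endo_trace (lie_bracket x y) = 0"
    using endo_trace_comp_commute[OF lin] by (simp add: lie_bracket_def endo_trace_diff o_def)
  moreover have "theta (lie_bracket x y) = lie_bracket x y"
    using assms by (simp add: theta_def inv_J lie_bracket_def fun_eq_iff J_simps pp_J lin_simps lin)
  ultimately show ?thesis
    by (simp add: kk_def sl_def lin_lie_bracket lin)
qed

section \<open>Homogeneous strings and the existence of normal triples\<close>

lemma homogeneous_pp: "x \<in> pp \<Longrightarrow> u \<in> Va \<union> Vb \<Longrightarrow> (x ^^ k) u \<in> Va \<union> Vb"
  by (induction k) (auto simp: Va_def Vb_def pp_J lin_simps pp_lin)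

text \<open>Up to a factor \<open>2\<close>, \<open>q + c * (q \<circ> J)\<close> is the projection
  of \<open>q\<close> to the functionals with eigenvalue \<open>c\<close> under composition with
  \<open>J\<close>; its value at \<open>u\<close> is \<open>1 + c * c = 2\<close>.\<close>

lemma homogeneous_functional:
  assumes u: "u \<in> Va \<union> Vb" "u \<noteq> 0"
  shows "\<exists>p c. functional p \<and> p u \<noteq> 0 \<and> (\<forall>v. p (J v) = c * p v)"
proof -
  obtain c where c: "J u = scale c u" "c * c = 1"
    using u by (auto simp: Va_def Vb_def intro: that[of 1] that[of "- 1"])
  obtain q where q: "functional q" "q u = 1"
    using exists_functional u by blast
  show ?thesis
  proof (intro exI conjI allI)
    show "functional (\<lambda>v. q v + c * q (J v))"
      by (intro functionalI) (simp_all add: functional_simps[OF q(1)] J_simps algebra_simps)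
    show "q u + c * q (J u) \<noteq> 0"
      using c q by (simp add: functional_simps)
    show "q (J v) + c * q (J (J v)) = c * (q v + c * q (J v))" for v
      using c by (simp add: algebra_simps flip: mult.assoc)
  qed
qed

text \<open>\<open>Suc m\<close> is the least exponent annihilating \<open>W\<close>, so that
  \<open>v\<close> starts a longest string. It can be taken homogeneous because one of
  \<open>v + J v\<close>, \<open>v - J v\<close> survives \<open>e ^^ m\<close>.\<close>

lemma homogeneous_top_vector:
  assumes e: "e \<in> NN" and W: "subspace W" "W \<noteq> {0}" "\<And>x. x \<in> W \<Longrightarrow> J x \<in> W"
  shows "\<exists>m. \<exists>v\<in>W. v \<in> Va \<union> Vb \<and> (e ^^ m) v \<noteq> 0 \<and> (\<forall>x\<in>W. (e ^^ Suc m) x = 0)"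
proof -
  note lin = lin_simps[OF lin_funpow[OF pp_lin]]
  have e_in_pp: "e \<in> pp"
    using e by (simp add: NN_def)
  obtain n where n: "\<forall>x\<in>W. (e ^^ n) x = 0" "\<And>k. k < n \<Longrightarrow> \<not> (\<forall>x\<in>W. (e ^^ k) x = 0)"
    using e exists_least_iff[of "\<lambda>n. \<forall>x\<in>W. (e ^^ n) x = 0"]
    by (auto simp: NN_def nilpotent_map_def)
  have "n \<noteq> 0"
    using n(1) W subspace_0 by auto
  then obtain m where m: "n = Suc m"
    using not0_implies_Suc by blast
  obtain v where v: "v \<in> W" "(e ^^ m) v \<noteq> 0"
    using n(2)[of m] m by auto
  have "(e ^^ m) (v + J v) + (e ^^ m) (v - J v) = scale 2 ((e ^^ m) v)"
    by (simp add: lin[OF e_in_pp] scale_2)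
  with v(2) have "(e ^^ m) (v + J v) \<noteq> 0 \<or> (e ^^ m) (v - J v) \<noteq> 0"
    by (metis add.right_neutral scale_eq_0_iff zero_neq_numeral)
  moreover have "v + J v \<in> W" "v - J v \<in> W"
    using v W by (simp_all add: subspace_add subspace_diff)
  moreover have "v + J v \<in> Va \<union> Vb" "v - J v \<in> Va \<union> Vb"
    by (simp_all add: Va_def Vb_def J_simps add.commute)
  ultimately show ?thesis
    using n(1) m by blast
qed

text \<open>The complement is stable under \<open>J\<close> because \<open>p\<close> is an
  eigenfunctional of \<open>J\<close> and \<open>J\<close> commutes with \<open>e ^^ k\<close> up to
  sign.\<close>

lemma homogeneous_string_basis:
  assumes e: "e \<in> NN"
  obtains S where "string_basis e S UNIV" "\<And>v d. (v, d) \<in> set S \<Longrightarrow> v \<in> Va \<union> Vb"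
proof -
  have e_in_pp: "e \<in> pp"
    using e by (simp add: NN_def)
  have "\<exists>S. string_basis e S UNIV \<and> (\<forall>(v, d) \<in> set S. v \<in> Va \<union> Vb)"
  proof (rule string_decomposition[where e = e and W = UNIV and P = "\<lambda>W. \<forall>x\<in>W. e x \<in> W \<and> J x \<in> W"
        and Q = "\<lambda>v d. v \<in> Va \<union> Vb"])
    fix W
    assume W: "subspace W" "\<forall>x\<in>W. e x \<in> W \<and> J x \<in> W" "W \<noteq> {0}"
    have "J x \<in> W" if "x \<in> W" for x
      using W(2) that by blast
    from homogeneous_top_vector[OF e W(1,3) this] obtain m v
      where v: "v \<in> W" "v \<in> Va \<union> Vb" "(e ^^ m) v \<noteq> 0" "\<And>x. x \<in> W \<Longrightarrow> (e ^^ Suc m) x = 0"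
      by metis
    obtain p c where p: "functional p" "p ((e ^^ m) v) \<noteq> 0" "\<And>v. p (J v) = c * p v"
      using homogeneous_functional[OF homogeneous_pp[OF e_in_pp v(2)] v(3)] by blast
    have "p ((e ^^ k) (e x)) = 0 \<and> p ((e ^^ k) (J x)) = 0" if x: "\<forall>k. p ((e ^^ k) x) = 0" for x k
    proof -
      have "p ((e ^^ Suc k) x) = 0"
        using x by blast
      moreover have "(e ^^ k) (J x) = scale ((- 1) ^ k) (J ((e ^^ k) x))"
        by (rule pow_J[OF e_in_pp])
      ultimately show ?thesis
        using x by (simp add: funpow_swap1 functional_simps[OF p(1)] p(3))
    qed
    then have U: "\<forall>x\<in>{u \<in> W. \<forall>k. p ((e ^^ k) u) = 0}.
        e x \<in> {u \<in> W. \<forall>k. p ((e ^^ k) u) = 0} \<and> J x \<in> {u \<in> W. \<forall>k. p ((e ^^ k) u) = 0}"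
      using W(2) by simp
    show "\<exists>v d p. v \<in> W \<and> v \<in> Va \<union> Vb \<and> d > 0 \<and> functional p \<and> (\<forall>x\<in>W. (e ^^ d) x = 0) \<and>
        p ((e ^^ (d - 1)) v) \<noteq> 0 \<and> (\<forall>x\<in>{u \<in> W. \<forall>k. p ((e ^^ k) u) = 0}.
        e x \<in> {u \<in> W. \<forall>k. p ((e ^^ k) u) = 0} \<and> J x \<in> {u \<in> W. \<forall>k. p ((e ^^ k) u) = 0})"
      by (rule exI[of _ v], rule exI[of _ "Suc m"], rule exI[of _ p]) (intro conjI v(1,2) p(1) U ballI v(4), simp_all add: p(2))
  qed (simp_all add: pp_lin[OF e_in_pp])
  then show ?thesis
    using that by blast
qed

text \<open>Each string of length \<open>d\<close> is made the irreducible
  \<open>sl(2)\<close>-module of dimension \<open>d\<close>, with weights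
  \<open>2 * i - (d - 1)\<close>; the relations are then checked on the string basis.\<close>

lemma normal_triple_exists:
  assumes e: "e \<in> NN"
  shows "\<exists>h f. normal_triple e h f"
proof -
  have e_in_pp: "e \<in> pp"
    using e by (simp add: NN_def)
  note le = pp_lin[OF e_in_pp]
  obtain S where S: "string_basis e S UNIV" and hom: "\<And>v d. (v, d) \<in> set S \<Longrightarrow> v \<in> Va \<union> Vb"
    using homogeneous_string_basis[OF e] by blast
  have top: "(e ^^ d) v = 0" if "(v, d) \<in> set S" for v d
    using S that by (auto simp: string_basis_def)
  \<comment> \<open>The coefficient is zero at \<open>i = 0\<close>, where \<open>i - 1\<close> is
    truncated, and also at \<open>i = d\<close>, in accordance with
    \<open>(e ^^ d) v = 0\<close>.\<close>
  obtain f where lf: "lin f" and f: "\<And>v d i. (v, d) \<in> set S \<Longrightarrow> i < d \<Longrightarrow>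
      f ((e ^^ i) v) = scale (of_nat i * (of_nat d - of_nat i)) ((e ^^ (i - 1)) v)"
    using string_linear_exists[OF S,
        of "\<lambda>v d i. scale (of_nat i * (of_nat d - of_nat i)) ((e ^^ (i - 1)) v)"] by blast
  define h where "h = lie_bracket e f"
  have lh: "lin h"
    by (simp add: h_def lin_lie_bracket le lf)
  have h: "h ((e ^^ i) v) = scale (2 * of_nat i - of_nat d + 1) ((e ^^ i) v)"
    if vd: "(v, d) \<in> set S" "i < d" for v d i
  proof -
    have "f (e ((e ^^ i) v)) = scale (of_nat (Suc i) * (of_nat d - of_nat (Suc i))) ((e ^^ i) v)"
    proof (cases "Suc i < d")
      case True
      then show ?thesis
        using f[OF vd(1) True] by simp
    next
      case False
      then have "d = Suc i"
        using vd by simp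
      then show ?thesis
        using top[OF vd(1)] by (simp add: lin_zero[OF lf])
    qed
    moreover have "e (f ((e ^^ i) v)) = scale (of_nat i * (of_nat d - of_nat i)) ((e ^^ i) v)"
      using f[OF vd] by (cases i) (simp_all add: lin_simps[OF le])
    moreover have "of_nat i * (of_nat d - of_nat i) - of_nat (Suc i) * (of_nat d - of_nat (Suc i))
        = (2 * of_nat i - of_nat d + 1 :: 'k)"
      by (simp add: algebra_simps)
    ultimately show ?thesis
      unfolding h_def lie_bracket_def by (metis scale_left_diff_distrib)
  qed
  have "lie_bracket h e = (\<lambda>v. scale 2 (e v))"
  proof (rule string_lin_eqI[OF S])
    fix v d i
    assume vd: "(v, d) \<in> set S" "i < d"
    have "h (e ((e ^^ i) v)) = scale (2 * of_nat (Suc i) - of_nat d + 1) (e ((e ^^ i) v))"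
    proof (cases "Suc i < d")
      case True
      then show ?thesis
        using h[OF vd(1) True] by simp
    next
      case False
      then have "d = Suc i"
        using vd by simp
      then show ?thesis
        using top[OF vd(1)] by (simp add: lin_zero[OF lh])
    qed
    moreover have "2 * of_nat (Suc i) - of_nat d + 1 - (2 * of_nat i - of_nat d + 1) = (2 :: 'k)"
      by simp
    ultimately show "lie_bracket h e ((e ^^ i) v) = scale 2 (e ((e ^^ i) v))"
      unfolding lie_bracket_def h[OF vd] lin_scale[OF le] by (metis scale_left_diff_distrib)
  next
    show "lin (lie_bracket h e)"
      by (intro lin_lie_bracket lh le)
    show "lin (\<lambda>v. scale 2 (e v))"
      by (intro linI) (simp_all add: lin_simps[OF le] scale_right_distrib mult.commute)
  qed
  moreover have "lie_bracket h f = (\<lambda>v. scale (- 2) (f v))"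
  proof (rule string_lin_eqI[OF S])
    fix v d i
    assume vd: "(v, d) \<in> set S" "i < d"
    show "lie_bracket h f ((e ^^ i) v) = scale (- 2) (f ((e ^^ i) v))"
    proof (cases i)
      case 0
      then show ?thesis
        using f[OF vd] h[OF vd] by (simp add: lie_bracket_def lin_simps[OF lf] lin_simps[OF lh])
    next
      case (Suc j)
      define c where "c = of_nat i * (of_nat d - of_nat i :: 'k)"
      define a where "a = 2 * of_nat j - of_nat d + (1 :: 'k)"
      have fb: "f ((e ^^ i) v) = scale c ((e ^^ j) v)"
        using f[OF vd] by (simp add: c_def Suc)
      have hb: "h ((e ^^ i) v) = scale (a + 2) ((e ^^ i) v)"
        unfolding h[OF vd] by (rule arg_cong2[of _ _ _ _ scale]) (simp_all add: a_def Suc)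
      have hb': "h ((e ^^ j) v) = scale a ((e ^^ j) v)"
        using h[OF vd(1), of j] vd by (simp add: a_def Suc)
      have "c * a - (a + 2) * c = - 2 * c"
        by (simp add: algebra_simps)
      then show ?thesis
        unfolding lie_bracket_def fb hb lin_scale[OF lf] lin_scale[OF lh] hb' scale_scale
        by (metis scale_left_diff_distrib)
    qed
  next
    show "lin (lie_bracket h f)"
      by (intro lin_lie_bracket lh lf)
    show "lin (\<lambda>v. scale (- 2) (f v))"
      by (intro linI) (simp_all add: lin_simps[OF lf] scale_right_distrib mult.commute)
  qed
  moreover have f_in_pp: "f \<in> pp"
  proof -
    have "(\<lambda>v. J (f v)) = (\<lambda>v. - f (J v))"
    proof (rule string_lin_eqI[OF S])
      fix v d i
      assume vd: "(v, d) \<in> set S" "i < d"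
      obtain c where c: "J v = scale c v"
        using hom[OF vd(1)] by (auto simp: Va_def Vb_def intro: that[of 1] that[of "- 1"])
      show "J (f ((e ^^ i) v)) = - f (J ((e ^^ i) v))"
      proof (cases i)
        case 0
        then show ?thesis
          using f[OF vd] by (simp add: c lin_simps[OF lf] J_simps)
      next
        case (Suc j)
        define a where "a = of_nat i * (of_nat d - of_nat i :: 'k)"
        have fb: "f ((e ^^ i) v) = scale a ((e ^^ j) v)"
          using f[OF vd] by (simp add: a_def Suc)
        have Jb: "J ((e ^^ n) v) = scale ((- 1) ^ n * c) ((e ^^ n) v)" for n
          by (simp add: J_pow[OF e_in_pp] c lin_simps[OF lin_funpow[OF le]])
        show ?thesis
          by (simp only: Jb fb J_simps lin_simps[OF lf]) (simp add: Suc mult.commute)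
      qed
    qed (auto intro!: linI simp: lin_simps[OF lf] J_simps)
    then show ?thesis
      by (auto simp: pp_iff lf fun_eq_iff)
  qed
  moreover have "h \<in> kk"
    using lie_bracket_in_kk[OF e_in_pp f_in_pp] by (simp add: h_def)
  ultimately have "normal_triple e h f"
    using e_in_pp by (simp add: normal_triple_def h_def)
  then show ?thesis
    by blast
qed

text \<open>The zero triple is itself normal, so \<open>e = 0\<close> is treated together with all
  other elements from here on.\<close>

lemma normal_triple_triple_of:
  assumes "e \<in> NN"
  shows "normal_triple e (fst (triple_of e)) (snd (triple_of e))"
proof (cases "e = (\<lambda>_. 0)")
  case True
  have "(\<lambda>_. 0) \<in> kk"
    using lie_bracket_in_kk[of e e] assms True by (simp add: NN_def lie_bracket_def)
  then show ?thesis
    using assms True by (simp add: triple_of_def normal_triple_def NN_def lie_bracket_def)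
next
  case False
  obtain h f where "normal_triple e h f"
    using normal_triple_exists[OF assms] by blast
  then have "case (SOME (h, f). normal_triple e h f) of (h, f) \<Rightarrow> normal_triple e h f"
    using someI[of "\<lambda>(h, f). normal_triple e h f" "(h, f)"] by simp
  with False show ?thesis
    by (simp add: triple_of_def case_prod_beta)
qed

section \<open>Strings adapted to a normal triple\<close>

lemma sl2_tripleI:
  assumes "normal_triple e h f"
  shows "sl2_triple scale Basis e h f"
proof (intro sl2_triple.intro sl2_triple_axioms.intro finite_dimensional_vector_space_axioms)
  show "lin e" "lin f" "lin h"
    using assms by (auto simp: normal_triple_def pp_iff kk_def sl_def)
  have "lie_bracket h e v = scale 2 (e v)" "lie_bracket h f v = scale (- 2) (f v)"
    "lie_bracket e f v = h v" for v
    using assms by (simp_all add: normal_triple_def)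
  then show "h (e v) = e (h v) + scale 2 (e v)" "h (f v) = f (h v) - scale 2 (f v)"
    "e (f v) = f (e v) + h v" for v
    unfolding lie_bracket_def by (simp_all add: diff_eq_eq add.commute)
qed

text \<open>Elements of \<open>p\<close> exchange \<open>Va\<close> and \<open>Vb\<close>, so
  homogeneity of a whole string reduces to that of its initial vector.\<close>

lemma adapted_strings_iff:
  assumes "e \<in> pp"
  shows "adapted_strings e h f S \<longleftrightarrow> string_basis e S UNIV \<and>
    (\<forall>(v, d) \<in> set S. f v = 0 \<and> h v = scale (- (of_nat d - 1)) v \<and> v \<in> Va \<union> Vb)"
proof -
  have "set (string_vectors e S) \<subseteq> Va \<union> Vb \<longleftrightarrow> (\<forall>(v, d) \<in> set S. v \<in> Va \<union> Vb)"
    if pos: "\<forall>(v, d) \<in> set S. d > 0"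
  proof
    assume *: "set (string_vectors e S) \<subseteq> Va \<union> Vb"
    have "v \<in> set (string_vectors e S)" if "(v, d) \<in> set S" for v d
      unfolding set_string_vectors using that pos by (intro CollectI exI[of _ v] exI[of _ d] exI[of _ 0]) auto
    with * show "\<forall>(v, d) \<in> set S. v \<in> Va \<union> Vb"
      by blast
  next
    assume *: "\<forall>(v, d) \<in> set S. v \<in> Va \<union> Vb"
    show "set (string_vectors e S) \<subseteq> Va \<union> Vb"
    proof
      fix b
      assume "b \<in> set (string_vectors e S)"
      then obtain v d i where "(v, d) \<in> set S" "b = (e ^^ i) v"
        by (auto simp: set_string_vectors)
      with * homogeneous_pp[OF assms, of v i] show "b \<in> Va \<union> Vb"
        by blast
    qed
  qed
  then show ?thesis
    unfolding adapted_strings_def string_basis_def Let_def string_vectors_def[symmetric]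
      case_prod_unfold ball_conj_distrib by argo
qed

text \<open>The splitting is repeated for a given triple. From a vector \<open>z\<close> of highest
  weight \<open>m\<close> one descends to \<open>w = (f ^^ m) z\<close>, which starts the string.
  The complement is stable because, on \<open>W\<close>, \<open>q\<close> is an eigenfunctional of
  \<open>h\<close> and \<open>J\<close> and vanishes on images of \<open>f\<close>.\<close>

lemma adapted_strings_exists:
  assumes e: "e \<in> NN" and T: "normal_triple e h f"
  shows "\<exists>S. adapted_strings e h f S"
proof -
  interpret sl2_triple scale Basis e h f
    by (rule sl2_tripleI[OF T])
  have e_in_pp: "e \<in> pp" and f_in_pp: "f \<in> pp"
    using T by (auto simp: normal_triple_def)
  let ?P = "\<lambda>W. \<forall>x\<in>W. e x \<in> W \<and> h x \<in> W \<and> f x \<in> W \<and> J x \<in> W"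
  let ?Q = "\<lambda>v d. f v = 0 \<and> h v = scale (- (of_nat d - 1)) v \<and> v \<in> Va \<union> Vb"
  have "\<exists>S. string_basis e S UNIV \<and> (\<forall>(v, d) \<in> set S. ?Q v d)"
  proof (rule string_decomposition[where e = e and W = UNIV and P = ?P and Q = ?Q])
    fix W
    assume W: "subspace W" "?P W" "W \<noteq> {0}"
    have "J x \<in> W" if "x \<in> W" for x
      using W(2) that by blast
    from homogeneous_top_vector[OF e W(1,3) this] obtain m v
      where v: "v \<in> W" "v \<in> Va \<union> Vb" "(e ^^ m) v \<noteq> 0" "\<And>x. x \<in> W \<Longrightarrow> (e ^^ Suc m) x = 0"
      by metis
    define z where "z = (e ^^ m) v"
    have stable: "\<forall>x\<in>W. e x \<in> W \<and> f x \<in> W" and top_zero: "\<forall>x\<in>W. (e ^^ Suc m) x = 0"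
      using W(2) v(4) by blast+
    note top = top_highest[OF stable top_zero] f_pow_top[OF stable top_zero]
      e_pow_f_pow_top[OF stable top_zero]
    note eW = e_pow_in[OF stable top_zero] and fW = f_pow_in[OF stable top_zero]
    have zW: "z \<in> W"
      unfolding z_def by (rule eW[OF v(1)])
    have z: "e z = 0" "h z = scale (of_nat m) z" "z \<noteq> 0" "z \<in> Va \<union> Vb"
      using top(1,2)[OF v(1)] v homogeneous_pp[OF e_in_pp] by (auto simp: z_def)
    obtain p c where p: "functional p" "p z \<noteq> 0" "\<And>v. p (J v) = c * p v"
      using homogeneous_functional[OF z(4,3)] by blast
    define w where "w = (f ^^ m) z"
    \<comment> \<open>Composing with \<open>e ^^ m \<circ> f ^^ m\<close> confines the functional to
      the weight \<open>m\<close>.\<close>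
    define q where "q x = p ((e ^^ m) ((f ^^ m) x))" for x
    have w: "w \<in> W" "f w = 0" "w \<in> Va \<union> Vb" "h w = scale (- of_nat m) w"
    proof -
      show "w \<in> W" "w \<in> Va \<union> Vb"
        using fW zW homogeneous_pp[OF f_in_pp z(4)] by (auto simp: w_def)
      show "f w = 0"
        using top(3)[OF zW z(1,2)] by (simp add: w_def)
      show "h w = scale (- of_nat m) w"
        by (simp only: w_def h_f_pow z f_pow_simps mult_2 of_nat_add scale_left_distrib) simp
    qed
    have q: "functional q"
      unfolding q_def by (intro functionalI) (simp_all add: e_pow_simps f_pow_simps functional_simps[OF p(1)])
    obtain a where a: "a \<noteq> 0" "(e ^^ m) w = scale a z"
      using e_pow_f_pow_highest[OF z(1,2), of m m] by (auto simp: w_def)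
    have qw: "q ((e ^^ m) w) \<noteq> 0"
      using a p(2) by (simp add: q_def f_pow_simps e_pow_simps functional_simps[OF p(1)] flip: w_def)
    have q_h: "q (h x) = of_nat m * q x" if "x \<in> W" for x
    proof -
      have "(e ^^ m) ((f ^^ m) (h x)) = (e ^^ m) (h ((f ^^ m) x) + scale (of_nat (2 * m)) ((f ^^ m) x))"
        by (simp add: h_f_pow)
      also have "\<dots> = h ((e ^^ m) ((f ^^ m) x))"
        by (simp add: h_e_pow e_pow_simps)
      also have "\<dots> = scale (of_nat m) ((e ^^ m) ((f ^^ m) x))"
        using top(2)[OF fW[OF that]] .
      finally show ?thesis
        by (simp add: q_def functional_simps[OF p(1)])
    qed
    have q_f: "q (f x) = 0" if "x \<in> W" for x
      using top(4)[OF that] by (simp add: q_def functional_simps[OF p(1)] funpow_swap1)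
    have q_J: "q (J x) = c * q x" for x
    proof -
      have "J ((e ^^ m) ((f ^^ m) x)) = (e ^^ m) ((f ^^ m) (J x))"
        by (simp add: J_pow[OF e_in_pp] pow_J[OF f_in_pp] e_pow_simps flip: power_mult_distrib)
      then show ?thesis
        by (simp add: q_def flip: p(3))
    qed
    let ?U = "{u \<in> W. \<forall>k. q ((e ^^ k) u) = 0}"
    have "q ((e ^^ k) (e x)) = 0 \<and> q ((e ^^ k) (h x)) = 0 \<and> q ((e ^^ k) (f x)) = 0 \<and>
        q ((e ^^ k) (J x)) = 0" if x: "x \<in> ?U" for x k
    proof -
      have xW: "x \<in> W" and x0: "q ((e ^^ k) x) = 0" for k
        using x by auto
      have "q ((e ^^ k) (e x)) = 0"
        using x0[of "Suc k"] by (simp add: funpow_swap1)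
      moreover have eh: "q ((e ^^ k) (h x)) = 0" for k
      proof -
        have "(e ^^ k) (h x) = h ((e ^^ k) x) - scale (of_nat (2 * k)) ((e ^^ k) x)"
          by (simp add: h_e_pow)
        then show ?thesis
          using q_h[OF eW[OF xW]] x0 by (simp add: functional_simps[OF q])
      qed
      moreover have "q ((e ^^ k) (f x)) = 0"
      proof (cases k)
        case 0
        then show ?thesis
          using q_f[OF xW] by simp
      next
        case (Suc j)
        have "(e ^^ Suc j) (f x) = f ((e ^^ Suc j) x) + scale (of_nat (Suc j)) ((e ^^ j) (h x + scale (of_nat j) x))"
          by (simp add: f_e_pow del: funpow.simps)
        then show ?thesis
          using q_f[OF eW[OF xW, of "Suc j"]] x0 eh[of j] unfolding Suc
          by (simp add: functional_simps[OF q] e_pow_simps del: funpow.simps)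
      qed
      moreover have "q ((e ^^ k) (J x)) = 0"
      proof -
        have "(e ^^ k) (J x) = scale ((- 1) ^ k) (J ((e ^^ k) x))"
          by (rule pow_J[OF e_in_pp])
        then show ?thesis
          using x0 by (simp add: functional_simps[OF q] q_J)
      qed
      ultimately show ?thesis
        by blast
    qed
    then have U: "?P ?U"
      using W(2) by simp
    show "\<exists>v d p. v \<in> W \<and> ?Q v d \<and> d > 0 \<and> functional p \<and> (\<forall>x\<in>W. (e ^^ d) x = 0) \<and>
        p ((e ^^ (d - 1)) v) \<noteq> 0 \<and> ?P {u \<in> W. \<forall>k. p ((e ^^ k) u) = 0}"
      by (rule exI[of _ w], rule exI[of _ "Suc m"], rule exI[of _ q]) (intro conjI w(1-3) q(1) U ballI v(4), simp_all add: w(4) qw)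
  qed (simp_all add: lin_e)
  then show ?thesis
    by (simp add: adapted_strings_iff[OF e_in_pp])
qed

end

section \<open>Centralizers\<close>

lemma lie_bracket_zeroD: "lie_bracket x y = (\<lambda>_. 0) \<Longrightarrow> x (y v) = y (x v)"
  by (simp add: lie_bracket_def fun_eq_iff)

lemma funpow_commute:
  assumes "\<And>v. x (y v) = y (x v)"
  shows "(x ^^ k) (y v) = y ((x ^^ k) v)"
  by (induction k) (simp_all add: assms)

context AIII
begin

text \<open>The results below hold for arbitrary adapted strings, so it suffices to recover some
  that produce the chosen diagram.\<close>

lemma ab_diagram_adapted:
  assumes "e \<in> NN"
  obtains S where "adapted_strings e (fst (triple_of e)) (snd (triple_of e)) S"
    "ab_diagram e = mset (map (\<lambda>s. map letter_of (jordan_string e s)) S)"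
proof -
  let ?P = "\<lambda>D. \<exists>S. adapted_strings e (fst (triple_of e)) (snd (triple_of e)) S \<and>
     D = mset (map (\<lambda>s. map letter_of (jordan_string e s)) S)"
  have "\<exists>D. ?P D"
    using adapted_strings_exists[OF assms normal_triple_triple_of[OF assms]] by blast
  then have "?P (ab_diagram e)"
    unfolding ab_diagram_def by (rule someI_ex)
  then show ?thesis
    using that by blast
qed

lemma same_initial_letters_iff:
  assumes "\<And>v d. (v, d) \<in> set S \<Longrightarrow> d > 0"
  shows "same_initial_letters (mset (map (\<lambda>s. map letter_of (jordan_string e s)) S)) \<longleftrightarrow>
    (\<forall>v w d. (v, d) \<in> set S \<longrightarrow> (w, d) \<in> set S \<longrightarrow> letter_of v = letter_of w)"
proof -
  have row: "length (map letter_of (jordan_string e (v, d))) = d"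
    "d > 0 \<Longrightarrow> hd (map letter_of (jordan_string e (v, d))) = letter_of v" for v d
    by (simp_all add: jordan_string_def hd_map)
  show ?thesis
    unfolding same_initial_letters_def
  proof (intro iffI allI impI)
    fix v w d
    assume *: "\<forall>d r s. r \<in># mset (map (\<lambda>s. map letter_of (jordan_string e s)) S) \<and>
        s \<in># mset (map (\<lambda>s. map letter_of (jordan_string e s)) S) \<and> length r = d \<and> length s = d \<longrightarrow>
        hd r = hd s"
      and vw: "(v, d) \<in> set S" "(w, d) \<in> set S"
    have in_rows: "map letter_of (jordan_string e (u, d)) \<in># mset (map (\<lambda>s. map letter_of (jordan_string e s)) S)"
      if "(u, d) \<in> set S" for u
      using that by auto
    from * in_rows[OF vw(1)] in_rows[OF vw(2)] row
    have "hd (map letter_of (jordan_string e (v, d))) = hd (map letter_of (jordan_string e (w, d)))"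
      by blast
    then show "letter_of v = letter_of w"
      using assms vw row by metis
  next
    fix d r s
    assume *: "\<forall>v w d. (v, d) \<in> set S \<longrightarrow> (w, d) \<in> set S \<longrightarrow> letter_of v = letter_of w"
      and rs: "r \<in># mset (map (\<lambda>s. map letter_of (jordan_string e s)) S) \<and>
        s \<in># mset (map (\<lambda>s. map letter_of (jordan_string e s)) S) \<and> length r = d \<and> length s = d"
    then obtain v n w k where "(v, n) \<in> set S" "r = map letter_of (jordan_string e (v, n))"
      "(w, k) \<in> set S" "s = map letter_of (jordan_string e (w, k))"
      by auto
    with rs row * assms show "hd r = hd s"
      by metis
  qed
qed

section \<open>Strings adapted to a fixed normal triple of \<open>e\<close>\<close>

context
  fixes e h f :: "'v \<Rightarrow> 'v" and S :: "('v \<times> nat) list"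
  assumes e: "e \<in> NN" and T: "normal_triple e h f" and adapted: "adapted_strings e h f S"
begin

lemma e_in_pp: "e \<in> pp"
  using e by (simp add: NN_def)

interpretation sl2_triple scale Basis e h f
  by (rule sl2_tripleI[OF T])

lemma strings_basis: "string_basis e S UNIV"
  using adapted by (simp add: adapted_strings_iff[OF e_in_pp])

lemma string_vector:
  assumes "(v, d) \<in> set S"
  shows "d > 0" "f v = 0" "h v = scale (- (of_nat d - 1)) v" "v \<in> Va \<union> Vb" "(e ^^ d) v = 0"
  using assms adapted strings_basis unfolding adapted_strings_iff[OF e_in_pp] string_basis_def by auto

lemma string_vector_nonzero:
  assumes "(v, d) \<in> set S" "i < d"
  shows "(e ^^ i) v \<noteq> 0"
proof -
  have "(e ^^ i) v \<in> set (string_vectors e S)"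
    using assms by (auto simp: set_string_vectors)
  then show ?thesis
    using strings_basis independent_nonzero by (auto simp: string_basis_def)
qed

lemma h_string:
  assumes "(v, d) \<in> set S"
  shows "h ((e ^^ i) v) = scale (2 * of_nat i - (of_nat d - 1)) ((e ^^ i) v)"
  using string_vector(3)[OF assms]
  by (simp add: h_e_pow e_pow_simps flip: scale_left_distrib)

text \<open>\<open>f ^^ n \<circ> e ^^ n\<close> is diagonal on the strings, with eigenvalue
  \<open>0\<close> exactly on the vectors killed by \<open>e ^^ n\<close>. It lets
  \<open>eigenvector_in_span\<close> handle the kernel of \<open>e ^^ n\<close>.\<close>

lemma f_pow_e_pow_string:
  assumes "(v, d) \<in> set S" "i < d"
  shows "n + i < d \<Longrightarrow> \<exists>c. c \<noteq> 0 \<and> (f ^^ n) ((e ^^ n) ((e ^^ i) v)) = scale c ((e ^^ i) v)"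
    and "d \<le> n + i \<Longrightarrow> (f ^^ n) ((e ^^ n) ((e ^^ i) v)) = 0"
proof -
  obtain k where k: "d = Suc k"
    using string_vector(1)[OF assms(1)] by (cases d) auto
  have v: "f v = 0" "h v = scale (- of_nat k) v"
    using string_vector[OF assms(1)] by (simp_all add: k)
  have pow: "(e ^^ n) ((e ^^ i) v) = (e ^^ (n + i)) v"
    by (simp add: funpow_add)
  show "\<exists>c. c \<noteq> 0 \<and> (f ^^ n) ((e ^^ n) ((e ^^ i) v)) = scale c ((e ^^ i) v)" if "n + i < d"
    using f_pow_e_pow_lowest[OF v, of n "n + i"] that by (simp add: k pow)
  show "(f ^^ n) ((e ^^ n) ((e ^^ i) v)) = 0" if "d \<le> n + i"
  proof -
    have "(e ^^ (n + i)) v = (e ^^ (n + i - d)) ((e ^^ d) v)"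
      using that by (metis comp_apply funpow_add le_add_diff_inverse2)
    then show ?thesis
      using string_vector(5)[OF assms(1)] by (simp add: pow e_pow_simps f_pow_simps)
  qed
qed

lemma J_string:
  assumes "(v, d) \<in> set S"
  obtains c where "c \<noteq> 0" "J v = scale c v"
  using string_vector(4)[OF assms] by (auto simp: Va_def Vb_def intro: that[of 1] that[of "- 1"])

text \<open>Commuting with \<open>e\<close> determines \<open>y\<close> by the images of the initial
  vectors. The three conditions on \<open>G\<close> ensure, in turn, compatibility with the end of
  the string, commutation with \<open>h\<close>, and anticommutation with \<open>J\<close>.\<close>

lemma centralizer_element_exists:
  assumes G: "\<And>u n. (u, n) \<in> set S \<Longrightarrow> (e ^^ n) (G u n) = 0 \<and>
      h (G u n) = scale (- (of_nat n - 1)) (G u n) \<and>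
      (\<forall>c. J u = scale c u \<longrightarrow> J (G u n) = scale (- c) (G u n))"
  obtains y where "y \<in> p_centralizer e" "lie_bracket h y = (\<lambda>_. 0)"
    "\<And>u n i. (u, n) \<in> set S \<Longrightarrow> i < n \<Longrightarrow> y ((e ^^ i) u) = (e ^^ i) (G u n)"
proof -
  obtain y where y: "lin y"
    "\<And>u n i. (u, n) \<in> set S \<Longrightarrow> i < n \<Longrightarrow> y ((e ^^ i) u) = (e ^^ i) (G u n)"
    using string_linear_exists[OF strings_basis, of "\<lambda>u n i. (e ^^ i) (G u n)"] by blast
  have zero: "lin (\<lambda>_. 0)"
    by (intro linI) simp_all
  have "lie_bracket e y = (\<lambda>_. 0)"
  proof (rule string_lin_eqI[OF strings_basis])
    fix u n i
    assume u: "(u, n) \<in> set S" "i < n"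
    have "y (e ((e ^^ i) u)) = e ((e ^^ i) (G u n))"
    proof (cases "Suc i < n")
      case True
      then show ?thesis
        using y(2)[OF u(1) True] by simp
    next
      case False
      then have "n = Suc i"
        using u by simp
      then show ?thesis
        using string_vector(5)[OF u(1)] G[OF u(1)] by (simp add: lin_zero[OF y(1)])
    qed
    then show "lie_bracket e y ((e ^^ i) u) = 0"
      by (simp add: lie_bracket_def y(2)[OF u])
  qed (intro lin_lie_bracket lin_e y(1) zero)+
  moreover have "lie_bracket h y = (\<lambda>_. 0)"
  proof (rule string_lin_eqI[OF strings_basis])
    fix u n i
    assume u: "(u, n) \<in> set S" "i < n"
    have "h ((e ^^ i) (G u n)) = scale (2 * of_nat i - (of_nat n - 1)) ((e ^^ i) (G u n))"
      using G[OF u(1)] by (simp add: h_e_pow e_pow_simps flip: scale_left_distrib)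
    then show "lie_bracket h y ((e ^^ i) u) = 0"
      by (simp add: lie_bracket_def y(2)[OF u] h_string[OF u(1)] lin_scale[OF y(1)])
  qed (intro lin_lie_bracket lin_h y(1) zero)+
  moreover have "y \<in> pp"
  proof -
    have "(\<lambda>v. J (y v)) = (\<lambda>v. - y (J v))"
    proof (rule string_lin_eqI[OF strings_basis])
      fix u n i
      assume u: "(u, n) \<in> set S" "i < n"
      obtain c where c: "J u = scale c u"
        using J_string[OF u(1)] by blast
      then have "J (G u n) = scale (- c) (G u n)"
        using G[OF u(1)] by blast
      then show "J (y ((e ^^ i) u)) = - y (J ((e ^^ i) u))"
        by (simp add: J_pow[OF e_in_pp] y(2)[OF u] c e_pow_simps lin_simps[OF y(1)])
    qed (auto intro!: linI simp: lin_simps[OF y(1)] J_simps)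
    then show ?thesis
      by (auto simp: pp_iff y(1) fun_eq_iff)
  qed
  ultimately show ?thesis
    using that[of y] y(2) by (simp add: p_centralizer_def)
qed

section \<open>Two rows of equal length with different initial letters\<close>

lemma opposite_letters:
  assumes v: "(v, d) \<in> set S" and w: "(w, d) \<in> set S" and "letter_of v \<noteq> letter_of w"
  obtains c where "J v = scale c v" "J w = scale (- c) w" "v \<noteq> w"
  using assms string_vector(4)[OF v] string_vector(4)[OF w]
  by (auto simp: letter_of_def Va_def Vb_def split: if_splits intro: that[of 1] that[of "- 1"])

text \<open>The string of \<open>v\<close> is carried to that of \<open>w\<close> and all others to
  zero; as \<open>v \<noteq> w\<close>, the square is zero.\<close>

lemma opposite_letters_nilpotent:
  assumes v: "(v, d) \<in> set S" and w: "(w, d) \<in> set S" and "letter_of v \<noteq> letter_of w"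
  shows "\<exists>y\<in>p_centralizer e. lie_bracket h y = (\<lambda>_. 0) \<and> y \<noteq> (\<lambda>_. 0) \<and> nilpotent_map y"
proof -
  obtain c where c: "J v = scale c v" "J w = scale (- c) w" "v \<noteq> w"
    using opposite_letters[OF assms] by blast
  have nonzero: "v \<noteq> 0" "w \<noteq> 0"
    using string_vector_nonzero[OF v, of 0] string_vector_nonzero[OF w, of 0] string_vector(1)[OF v]
    by auto
  obtain y where y: "y \<in> p_centralizer e" "lie_bracket h y = (\<lambda>_. 0)"
    "\<And>u n i. (u, n) \<in> set S \<Longrightarrow> i < n \<Longrightarrow>
      y ((e ^^ i) u) = (e ^^ i) (if u = v \<and> n = d then w else 0)"
  proof (rule centralizer_element_exists[of "\<lambda>u n. if u = v \<and> n = d then w else 0"])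
    show "(e ^^ n) (if u = v \<and> n = d then w else 0) = 0 \<and>
      h (if u = v \<and> n = d then w else 0) = scale (- (of_nat n - 1)) (if u = v \<and> n = d then w else 0) \<and>
      (\<forall>a. J u = scale a u \<longrightarrow> J (if u = v \<and> n = d then w else 0) = scale (- a) (if u = v \<and> n = d then w else 0))"
      for u n
      using c nonzero string_vector[OF w] by (auto simp: e_pow_simps lin_zero[OF lin_h] J_simps)
  qed blast
  have ly: "lin y"
    using y(1) by (simp add: p_centralizer_def pp_lin)
  have "(\<lambda>u. y (y u)) = (\<lambda>_. 0)"
  proof (rule string_lin_eqI[OF strings_basis])
    show "y (y ((e ^^ i) u)) = 0" if "(u, n) \<in> set S" "i < n" for u n i
      using y(3)[OF that] y(3)[OF w, of i] that c(3) by (auto simp: e_pow_simps lin_zero[OF ly])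
  qed (auto intro!: linI simp: lin_simps[OF ly])
  then have "nilpotent_map y"
    unfolding nilpotent_map_def by (intro exI[of _ 2]) (simp add: numeral_2_eq_2 fun_eq_iff)
  moreover have "y v = w"
    using y(3)[OF v, of 0] string_vector(1)[OF v] by simp
  ultimately show ?thesis
    using y nonzero by auto
qed

text \<open>The strings of \<open>v\<close> and \<open>w\<close> are exchanged, so the powers of
  \<open>y\<close> never kill \<open>v\<close>.\<close>

lemma opposite_letters_not_nilpotent:
  assumes v: "(v, d) \<in> set S" and w: "(w, d) \<in> set S" and "letter_of v \<noteq> letter_of w"
  shows "\<exists>y\<in>p_centralizer e. \<not> nilpotent_map y"
proof -
  obtain c where c: "J v = scale c v" "J w = scale (- c) w" "v \<noteq> w"
    using opposite_letters[OF assms] by blast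
  have nonzero: "v \<noteq> 0" "w \<noteq> 0"
    using string_vector_nonzero[OF v, of 0] string_vector_nonzero[OF w, of 0] string_vector(1)[OF v]
    by auto
  have eigenvalue_w: "- scale c w = scale a w \<longleftrightarrow> a = - c" for a
    using nonzero by (metis scale_cancel_right scale_minus_left)
  define G where "G u n = (if u = v \<and> n = d then w else if u = w \<and> n = d then v else 0)" for u n
  obtain y where y: "y \<in> p_centralizer e"
    "\<And>u n i. (u, n) \<in> set S \<Longrightarrow> i < n \<Longrightarrow> y ((e ^^ i) u) = (e ^^ i) (G u n)"
  proof (rule centralizer_element_exists[of G])
    show "(e ^^ n) (G u n) = 0 \<and> h (G u n) = scale (- (of_nat n - 1)) (G u n) \<and>
      (\<forall>a. J u = scale a u \<longrightarrow> J (G u n) = scale (- a) (G u n))" for u n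
      using c nonzero string_vector[OF w] string_vector[OF v]
      by (auto simp: G_def e_pow_simps lin_zero[OF lin_h] J_simps eigenvalue_w)
  qed blast
  have swap: "y v = w" "y w = v"
    using y(2)[OF v, of 0] y(2)[OF w, of 0] string_vector(1)[OF v] c(3) by (simp_all add: G_def)
  have "(y ^^ n) v = v \<or> (y ^^ n) v = w" for n
    by (induction n) (simp, metis comp_apply funpow.simps(2) swap)
  then have "\<not> nilpotent_map y"
    using nonzero unfolding nilpotent_map_def by metis
  with y(1) show ?thesis
    by blast
qed

section \<open>Rows of equal length with the same initial letter\<close>

lemma same_letters_eigenvalue:
  assumes "\<And>v w. (v, d) \<in> set S \<Longrightarrow> (w, d) \<in> set S \<Longrightarrow> letter_of v = letter_of w"
  obtains c where "c \<noteq> 0" "\<And>v. (v, d) \<in> set S \<Longrightarrow> J v = scale c v"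
proof (cases "\<exists>v\<in>Va. (v, d) \<in> set S")
  case True
  then have "v \<in> Va" if "(v, d) \<in> set S" for v
    using assms that by (metis letter.distinct(1) letter_of_def)
  then show ?thesis
    using that[of 1] by (simp add: Va_def)
next
  case False
  then have "v \<in> Vb" if "(v, d) \<in> set S" for v
    using string_vector(4)[OF that] that by blast
  then show ?thesis
    using that[of "- 1"] by (simp add: Vb_def)
qed

lemma diagonal_on_strings:
  assumes "b \<in> set (string_vectors e S)"
  shows "\<exists>c. h b = scale c b" "\<exists>c. J b = scale c b" "\<exists>c. (f ^^ n) ((e ^^ n) b) = scale c b"
proof -
  obtain v d i where b: "(v, d) \<in> set S" "i < d" "b = (e ^^ i) v"
    using assms by (auto simp: set_string_vectors)
  show "\<exists>c. h b = scale c b"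
    using h_string[OF b(1)] b(3) by blast
  obtain c where "J v = scale c v"
    using J_string[OF b(1)] by blast
  then have "J b = scale ((- 1) ^ i * c) b"
    by (simp add: b(3) J_pow[OF e_in_pp] e_pow_simps)
  then show "\<exists>c. J b = scale c b"
    by blast
  show "\<exists>c. (f ^^ n) ((e ^^ n) b) = scale c b"
  proof (cases "n + i < d")
    case True
    then show ?thesis
      using f_pow_e_pow_string(1)[OF b(1,2)] unfolding b(3) by blast
  next
    case False
    then show ?thesis
      using f_pow_e_pow_string(2)[OF b(1,2), of n] unfolding b(3) by (intro exI[of _ 0]) simp
  qed
qed

lemma lin_f_pow_e_pow: "lin (\<lambda>v. (f ^^ n) ((e ^^ n) v))"
  by (intro linI) (simp_all add: e_pow_simps f_pow_simps)

lemma independent_strings: "independent (set (string_vectors e S))"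
  and span_strings: "x \<in> span (set (string_vectors e S))"
  using strings_basis by (simp_all add: string_basis_def)

text \<open>For \<open>v\<close> starting a string of length \<open>d\<close>, \<open>y v\<close>
  has the weight of \<open>v\<close>, is killed by \<open>e ^^ d\<close>, and has the opposite
  eigenvalue under \<open>J\<close>. No basis vector has all three properties, so
  \<open>y v = 0\<close>.\<close>

lemma same_letters_centralizer_zero:
  assumes same: "\<And>v w d. (v, d) \<in> set S \<Longrightarrow> (w, d) \<in> set S \<Longrightarrow> letter_of v = letter_of w"
    and y: "y \<in> p_centralizer e" "lie_bracket h y = (\<lambda>_. 0)"
  shows "y = (\<lambda>_. 0)"
proof -
  have yp: "y \<in> pp" and ye: "e (y v) = y (e v)" and yh: "h (y v) = y (h v)" for v
    using y lie_bracket_zeroD[of e y v] lie_bracket_zeroD[of h y v] by (auto simp: p_centralizer_def)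
  note ly = pp_lin[OF yp]
  have kill: "y v = 0" if v: "(v, d) \<in> set S" for v d
  proof -
    obtain c where c: "c \<noteq> 0" "\<And>w. (w, d) \<in> set S \<Longrightarrow> J w = scale c w"
      using same_letters_eigenvalue same by metis
    let ?B = "set (string_vectors e S)"
    let ?B1 = "{b \<in> ?B. h b = scale (- (of_nat d - 1)) b}"
    let ?B2 = "{b \<in> ?B1. (f ^^ d) ((e ^^ d) b) = scale 0 b}"
    let ?B3 = "{b \<in> ?B2. J b = scale (- c) b}"
    have ind: "independent ?B1" "independent ?B2"
      by (rule independent_mono[OF independent_strings]; blast)+
    have "y v \<in> span ?B1"
      using string_vector(3)[OF v] diagonal_on_strings(1)
      by (intro eigenvector_in_span independent_strings span_strings lin_h) (auto simp: yh lin_simps[OF ly])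
    then have "y v \<in> span ?B2"
      using diagonal_on_strings(3) funpow_commute[of e y d v, OF ye] string_vector(5)[OF v]
      by (intro eigenvector_in_span[OF ind(1) _ lin_f_pow_e_pow])
        (auto simp: lin_simps[OF ly] f_pow_simps)
    then have "y v \<in> span ?B3"
      using diagonal_on_strings(2) pp_J[OF yp, of v] c(2)[OF v]
      by (intro eigenvector_in_span[OF ind(2) _ J_linear]) (auto simp: lin_simps[OF ly])
    moreover have "?B3 = {}"
    proof (rule ccontr)
      assume "?B3 \<noteq> {}"
      then obtain b where b: "b \<in> ?B" "h b = scale (- (of_nat d - 1)) b"
        "(f ^^ d) ((e ^^ d) b) = 0" "J b = scale (- c) b"
        by auto
      obtain w n i where w: "(w, n) \<in> set S" "i < n" "b = (e ^^ i) w"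
        using b(1) by (auto simp: set_string_vectors)
      have "b \<noteq> 0"
        using string_vector_nonzero[OF w(1,2)] w(3) by simp
      then have "2 * of_nat i - (of_nat n - 1) = - (of_nat d - 1 :: 'k)"
        using b(2) h_string[OF w(1), of i] w(3) by (metis scale_right_imp_eq)
      then have "of_nat (2 * i + d) = (of_nat n :: 'k)"
        by (simp add: algebra_simps)
      then have n: "2 * i + d = n"
        by (simp only: of_nat_eq_iff)
      \<comment> \<open>The weight puts \<open>b\<close> at position \<open>i\<close> of a string of
        length \<open>d + 2 * i\<close>; being killed by \<open>e ^^ d\<close> leaves only
        \<open>i = 0\<close>.\<close>
      have "\<not> d + i < n"
        using f_pow_e_pow_string(1)[OF w(1,2), of d] b(3) w(3) \<open>b \<noteq> 0\<close> by auto
      with n have "i = 0" "n = d"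
        by auto
      then have "scale c b = scale (- c) b"
        using c(2)[of w] w b(4) by simp
      then have "c = - c"
        using \<open>b \<noteq> 0\<close> by (rule scale_right_imp_eq[rotated])
      then show False
        using c(1) by simp
    qed
    ultimately have "y v \<in> span {}"
      by (simp only:)
    then show ?thesis
      by simp
  qed
  show ?thesis
  proof (rule string_lin_eqI[OF strings_basis ly])
    show "y ((e ^^ i) v) = 0" if "(v, d) \<in> set S" for v d i
      using funpow_commute[of e y i v, OF ye] kill[OF that] by (simp add: e_pow_simps)
  qed (intro linI, simp_all)
qed

text \<open>This says that \<open>y\<close> induces zero on
  \<open>ker e^d / (ker e^(d-1) + e (ker e^(d+1)))\<close>: there \<open>J\<close> is the scalar
  \<open>c\<close>, while \<open>y\<close> anticommutes with \<open>J\<close>.\<close>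

lemma same_letters_centralizer_image:
  assumes same: "\<And>v w. (v, d) \<in> set S \<Longrightarrow> (w, d) \<in> set S \<Longrightarrow> letter_of v = letter_of w"
    and y: "y \<in> p_centralizer e" and d: "d > 0" and x: "(e ^^ d) x = 0"
  shows "\<exists>a b. y x = a + e b \<and> (e ^^ (d - 1)) a = 0 \<and> (e ^^ Suc d) b = 0"
proof -
  have yp: "y \<in> pp" and ye: "e (y v) = y (e v)" for v
    using y lie_bracket_zeroD[of e y v] by (auto simp: p_centralizer_def)
  note ly = pp_lin[OF yp]
  obtain c where c: "c \<noteq> 0" "\<And>v. (v, d) \<in> set S \<Longrightarrow> J v = scale c v"
    using same_letters_eigenvalue same by metis
  define A where "A = {a + e b | a b. (e ^^ (d - 1)) a = 0 \<and> (e ^^ Suc d) b = 0}"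
  \<comment> \<open>\<open>M\<close> contains the initial vectors of the strings of length
    \<open>d\<close>. The sum of \<open>M\<close> and \<open>A\<close> need not be direct.\<close>
  define M where "M = {m. J m = scale c m \<and> (e ^^ d) m = 0}"
  have AI: "a + e b \<in> A" if "(e ^^ (d - 1)) a = 0" "(e ^^ Suc d) b = 0" for a b
    using that unfolding A_def by blast
  have AE: "\<exists>a b. u = a + e b \<and> (e ^^ (d - 1)) a = 0 \<and> (e ^^ Suc d) b = 0" if "u \<in> A" for u
    using that unfolding A_def by blast
  have A: "subspace A"
  proof (rule subspaceI)
    show "0 \<in> A"
      using AI[of 0 0] by (simp add: e_pow_simps lin_simps[OF lin_e])
  next
    fix u w
    assume "u \<in> A" "w \<in> A"
    then obtain a b a' b' where ab: "u = a + e b" "(e ^^ (d - 1)) a = 0" "(e ^^ Suc d) b = 0"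
      "w = a' + e b'" "(e ^^ (d - 1)) a' = 0" "(e ^^ Suc d) b' = 0"
      using AE by metis
    then have "(a + a') + e (b + b') \<in> A"
      by (intro AI) (simp_all only: e_pow_simps add_0)
    then show "u + w \<in> A"
      by (simp add: ab lin_simps[OF lin_e] algebra_simps)
  next
    fix k u
    assume "u \<in> A"
    then obtain a b where ab: "u = a + e b" "(e ^^ (d - 1)) a = 0" "(e ^^ Suc d) b = 0"
      using AE by metis
    then have "scale k a + e (scale k b) \<in> A"
      by (intro AI) (simp_all only: e_pow_simps scale_zero_right)
    then show "scale k u \<in> A"
      by (simp add: ab lin_simps[OF lin_e] scale_right_distrib)
  qed
  have yA: "y u \<in> A" and JA: "J u \<in> A" if "u \<in> A" for u
  proof -
    from AE[OF that] obtain a b where ab: "u = a + e b" "(e ^^ (d - 1)) a = 0" "(e ^^ Suc d) b = 0"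
      by blast
    have "y a + e (y b) \<in> A"
      using ab(2,3) by (intro AI) (simp_all only: funpow_commute[of e y, OF ye] lin_zero[OF ly])
    then show "y u \<in> A"
      by (simp add: ab(1) lin_simps[OF ly] ye)
    have "J a + e (- J b) \<in> A"
      using ab(2,3) by (intro AI) (simp_all only: e_pow_simps pow_J[OF e_in_pp] J_simps scale_zero_right neg_equal_0_iff_equal)
    then show "J u \<in> A"
      by (simp add: ab(1) J_simps pp_J[OF e_in_pp] lin_simps[OF lin_e])
  qed
  have M: "subspace M"
    by (rule subspaceI)
      (simp_all add: M_def J_simps e_pow_simps scale_right_distrib mult.commute)
  have decomp: "\<exists>m\<in>M. \<exists>a\<in>A. u = m + a" if u: "(e ^^ d) u = 0" for u
  proof -
    let ?B = "{b \<in> set (string_vectors e S). (f ^^ d) ((e ^^ d) b) = scale 0 b}"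
    have "u \<in> span ?B"
      using diagonal_on_strings(3) u
      by (intro eigenvector_in_span[OF independent_strings span_strings lin_f_pow_e_pow])
        (simp_all add: f_pow_simps)
    moreover have "?B \<subseteq> {m + a | m a. m \<in> M \<and> a \<in> A}"
    proof
      fix b
      assume "b \<in> ?B"
      then obtain v n i where b: "(v, n) \<in> set S" "i < n" "b = (e ^^ i) v" "(f ^^ d) ((e ^^ d) b) = 0"
        by (auto simp: set_string_vectors)
      have ni: "\<not> d + i < n"
        using f_pow_e_pow_string(1)[OF b(1,2), of d] string_vector_nonzero[OF b(1,2)] b(3,4) by auto
      have top: "(e ^^ k) v = 0" if "n \<le> k" for k
      proof -
        have "(e ^^ k) v = (e ^^ (k - n)) ((e ^^ n) v)"
          using that by (metis comp_apply funpow_add le_add_diff_inverse2)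
        then show ?thesis
          using string_vector(5)[OF b(1)] by (simp add: e_pow_simps)
      qed
      \<comment> \<open>An initial vector of a string of length \<open>d\<close> lies in
        \<open>M\<close>, one of a shorter string is killed by \<open>e ^^ (d - 1)\<close>, and any
        later vector is \<open>e\<close> of its predecessor.\<close>
      have "b \<in> M \<or> b \<in> A"
      proof (cases i)
        case 0
        show ?thesis
        proof (cases "n = d")
          case True
          then show ?thesis
            using 0 b top[of d] c(2) by (simp add: M_def)
        next
          case False
          then have "(e ^^ (d - 1)) v = 0"
            using ni 0 by (intro top) simp
          then show ?thesis
            using AI[of v 0] 0 b(3) by (simp add: e_pow_simps lin_simps[OF lin_e])
        qed
      next
        case (Suc j)
        have "(e ^^ Suc d) ((e ^^ j) v) = (e ^^ (Suc d + j)) v"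
          by (simp only: funpow_add o_apply)
        also have "\<dots> = 0"
          using ni Suc by (intro top) simp
        finally show ?thesis
          using AI[of 0 "(e ^^ j) v"] Suc b(3) by (simp add: e_pow_simps)
      qed
      moreover have "b = b + 0" "b = 0 + b"
        by simp_all
      ultimately show "b \<in> {m + a | m a. m \<in> M \<and> a \<in> A}"
        using subspace_0[OF A] subspace_0[OF M] by blast
    qed
    ultimately have "u \<in> {m + a | m a. m \<in> M \<and> a \<in> A}"
      using span_minimal[OF _ subspace_sums[OF M A]] by blast
    then show ?thesis
      by blast
  qed
  have yM: "y m \<in> A" if m: "m \<in> M" for m
  proof -
    have "(e ^^ d) (y m) = 0"
      using m by (simp add: funpow_commute[of e y, OF ye] M_def lin_zero[OF ly])
    then obtain m' a where ma: "m' \<in> M" "a \<in> A" "y m = m' + a"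
      using decomp by blast
    have "J (y m) = scale (- c) (y m)"
      using m by (simp add: pp_J[OF yp] M_def lin_simps[OF ly])
    \<comment> \<open>Modulo \<open>A\<close>, \<open>J\<close> acts on \<open>m'\<close> both as
      \<open>c\<close> and as \<open>- c\<close>, so \<open>2 * c\<close> times \<open>m'\<close>
      lies in \<open>A\<close>.\<close>
    then have "scale c m' + J a = scale (- c) m' + scale (- c) a"
      using ma by (simp add: J_simps M_def scale_right_distrib)
    then have "scale (2 * c) m' = scale (- c) a - J a"
      by (simp add: algebra_simps scale_2 flip: scale_scale)
    then have "scale (2 * c) m' \<in> A"
      using subspace_diff[OF A subspace_scale[OF A ma(2)] JA[OF ma(2)]] by (simp only:)
    then have "scale (inverse (2 * c)) (scale (2 * c) m') \<in> A"
      by (rule subspace_scale[OF A])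
    then have "m' \<in> A"
      using c(1) by simp
    then show ?thesis
      using ma A by (simp add: subspace_add)
  qed
  obtain m a where "m \<in> M" "a \<in> A" "x = m + a"
    using decomp[OF x] by blast
  then have "y x \<in> A"
    using yM yA A by (simp add: lin_simps[OF ly] subspace_add)
  then show ?thesis
    by (rule AE)
qed

text \<open>On \<open>e ^^ j\<close> applied to the kernel of \<open>e ^^ d\<close> the number \<open>2 * j - d\<close> measures how close
  a vector is to being killed by \<open>e\<close>, and each application of \<open>y\<close> increases it by one.\<close>

lemma same_letters_centralizer_nilpotent:
  assumes same: "\<And>v w d. (v, d) \<in> set S \<Longrightarrow> (w, d) \<in> set S \<Longrightarrow> letter_of v = letter_of w"
    and y: "y \<in> p_centralizer e"
  shows "nilpotent_map y"
proof -
  have ly: "lin y" and ye: "e (y v) = y (e v)" for v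
    using y lie_bracket_zeroD[of e y v] by (auto simp: p_centralizer_def pp_iff)
  obtain N where N: "\<And>v. (e ^^ N) v = 0"
    using e by (auto simp: NN_def nilpotent_map_def)
  have "(y ^^ k) ((e ^^ j) x) = 0" if "(e ^^ d) x = 0" "2 * N + d \<le> 2 * j + k" for k d j x
    using that
  proof (induction k arbitrary: d j x)
    case 0
    then have "N \<le> j"
      by simp
    then have "(e ^^ j) x = (e ^^ (j - N)) ((e ^^ N) x)"
      by (metis comp_apply funpow_add le_add_diff_inverse2)
    then show ?case
      using N by (simp add: e_pow_simps)
  next
    case (Suc k)
    show ?case
    proof (cases "d = 0")
      case True
      then show ?thesis
        using Suc.prems by (simp add: e_pow_simps lin_simps[OF ly] lin_simps[OF lin_funpow[OF ly]])
    next
      case False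
      then have "\<exists>a b. y x = a + e b \<and> (e ^^ (d - 1)) a = 0 \<and> (e ^^ Suc d) b = 0"
        by (intro same_letters_centralizer_image[OF _ y _ Suc.prems(1)] same) simp_all
      then obtain a b where ab: "y x = a + e b" "(e ^^ (d - 1)) a = 0" "(e ^^ Suc d) b = 0"
        by blast
      have "(y ^^ Suc k) ((e ^^ j) x) = (y ^^ k) ((e ^^ j) (y x))"
        by (simp add: funpow_swap1 funpow_commute[of e y, OF ye])
      also have "\<dots> = (y ^^ k) ((e ^^ j) a) + (y ^^ k) ((e ^^ Suc j) b)"
        by (simp add: ab(1) e_pow_simps lin_simps[OF lin_funpow[OF ly]] funpow_swap1)
      \<comment> \<open>The two terms fall under the pairs \<open>(d - 1, j)\<close> and
        \<open>(d + 1, j + 1)\<close>; both raise \<open>2 * j - d\<close> by one.\<close>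
      also have "\<dots> = 0"
        using Suc.IH[OF ab(2), of j] Suc.IH[OF ab(3), of "Suc j"] Suc.prems(2) False by simp
      finally show ?thesis .
    qed
  qed
  \<comment> \<open>Every vector is killed by \<open>e ^^ N\<close>, so \<open>d = N\<close> and
    \<open>j = 0\<close> give the bound \<open>2 * N + N \<le> k\<close>.\<close>
  from this[OF N, of 0 "3 * N"] show ?thesis
    unfolding nilpotent_map_def by (intro exI[of _ "3 * N"]) simp
qed

end

text \<open>\<open>p_zero\<close> and \<open>ab_diagram\<close> refer to the same chosen triple, so
  the strings behind the diagram also govern \<open>p_zero e\<close>.\<close>

lemma distinguished_iff:
  assumes e: "e \<in> NN"
  shows "p_distinguished e \<longleftrightarrow> same_initial_letters (ab_diagram e)"
    and "almost_p_distinguished e \<longleftrightarrow> same_initial_letters (ab_diagram e)"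
proof -
  let ?h = "fst (triple_of e)" and ?f = "snd (triple_of e)"
  have T: "normal_triple e ?h ?f"
    by (rule normal_triple_triple_of[OF e])
  obtain S where S: "adapted_strings e ?h ?f S"
    "ab_diagram e = mset (map (\<lambda>s. map letter_of (jordan_string e s)) S)"
    using ab_diagram_adapted[OF e] by blast
  have same: "same_initial_letters (ab_diagram e) \<longleftrightarrow>
      (\<forall>v w d. (v, d) \<in> set S \<longrightarrow> (w, d) \<in> set S \<longrightarrow> letter_of v = letter_of w)"
    unfolding S(2) using string_vector(1)[OF e T S(1)] by (rule same_initial_letters_iff)
  show "p_distinguished e \<longleftrightarrow> same_initial_letters (ab_diagram e)"
    using opposite_letters_not_nilpotent[OF e T S(1)] same_letters_centralizer_nilpotent[OF e T S(1)] e
    unfolding p_distinguished_def same NN_def p_centralizer_def by blast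
  show "almost_p_distinguished e \<longleftrightarrow> same_initial_letters (ab_diagram e)"
    using opposite_letters_nilpotent[OF e T S(1)] same_letters_centralizer_zero[OF e T S(1)] e
    unfolding almost_p_distinguished_def same p_zero_def by blast
qed

end

theorem proposition3p6:
  fixes scale :: "'k::{alg_closed_field, field_char_0} \<Rightarrow> 'v::ab_group_add \<Rightarrow> 'v"
    and Basis :: "'v set" and J :: "'v \<Rightarrow> 'v"
  assumes "AIII scale Basis J"
  shows "{e. AIII.p_distinguished scale Basis J e} = {e. AIII.almost_p_distinguished scale Basis J e} \<and>
    {e. AIII.almost_p_distinguished scale Basis J e} =
      {e \<in> AIII.NN scale Basis J. same_initial_letters (AIII.ab_diagram scale Basis J e)}"
proof -
  interpret AIII scale Basis J
    by (rule assms)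
  have "p_distinguished e \<longleftrightarrow> e \<in> NN \<and> same_initial_letters (ab_diagram e)"
    "almost_p_distinguished e \<longleftrightarrow> e \<in> NN \<and> same_initial_letters (ab_diagram e)" for e
    using distinguished_iff[of e] by (auto simp: p_distinguished_def almost_p_distinguished_def)
  then show ?thesis
    by auto
qed

end
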